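(* On every valid cover array $C[1\dots n]$ (the minimal-cover or maximal-cover array of some string of length $n$), Algorithm SIMA (described in the context), with the graph stored by adjacency lists, its connected components computed by depth-first search, and the border lengths $B[i]$ of the constructed prefixes computed online by the standard failure-function (KMP) method, runs in $O(n)$ time.
   Context: Strings are indexed from 1; $x[i\dots j]$ denotes a factor. A border of a string $u$ is a string that is both a proper prefix and a suffix of $u$ (possibly empty). A string $w$ of length $m$ is a cover of $y[1\dots k]$ if $m<k$ and there is a set $P\subseteq\{1,\dots,k-m+1\}$ with $y[p\dots p+m-1]=w$ for all $p\in P$ and $\bigcup_{p\in P}\{p,\dots,p+m-1\}=\{1,\dots,k\}$. The minimal-cover array $C$ of $y[1\dots n]$ has $C[i]$ equal to the length of the shortest cover of $y[1\dots i]$ if one exists, and $0$ otherwise; the maximal-cover array stores the length of the longest cover instead. Algorithm SIMA, on input an integer array $C[1\dots n]$: Step 1 (MaxToMin): for $i=1,\dots,n$ in increasing order, if $C[i]\ne 0$ and $C[C[i]]\ne 0$, replace $C[i]$ by $C[C[i]]$. Step 2 (Prune): set $l:=0$; for $i=n,n-1,\dots,1$: if $l\ge C[i]$ set $C[i]:=0$; then set $l:=\max(0,\max(l,C[i])-1)$. Call the resulting array $C^P$. Step 3 (Inference): build the undirected graph $G$ on vertex set $\{1,\dots,n\}$ with an edge $\{j,\ i-C^P[i]+j\}$ for every $i\in\{1,\dots,n\}$ and every $1\le j\le C^P[i]$. Process positions $i=1,\dots,n$ in increasing order; whenever $x[i]$ is not yet assigned (so $i$ is the smallest element of its connected component in $G$),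 choose a letter $c$ as follows: if $i=1$, $c=a$; otherwise let $B[i-1]$ be the length of the longest border of the already constructed prefix $x[1\dots i-1]$, and set $c=b$ if $x[B[i-1]+1]=a$ and $c=a$ otherwise. Assign $c$ to $x[p]$ for every vertex $p$ in the connected component of $i$. Output $x[1\dots n]$. *)

theory Defs
  imports Main "HOL-Library.Sublist"
begin

section \<open>Covers, borders and cover arrays\<close>

text \<open>Strings are lists, but positions are counted from 1: the letter of \<open>y\<close> at position \<open>p\<close>
  is \<open>y ! (p - 1)\<close>. Arrays indexed by \<open>1..n\<close> are functions on \<open>nat\<close>; their values outside
  \<open>{1..n}\<close> are irrelevant.\<close>

definition factor :: "'a list \<Rightarrow> nat \<Rightarrow> nat \<Rightarrow> 'a list" where
  "factor y p m = take m (drop (p - 1) y)"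

definition is_cover :: "'a list \<Rightarrow> 'a list \<Rightarrow> bool" where
  "is_cover w y \<longleftrightarrow> length w < length y \<and>
    (\<exists>P \<subseteq> {1..length y - length w + 1}.
       (\<forall>p\<in>P. factor y p (length w) = w) \<and>
       (\<Union>p\<in>P. {p..<p + length w}) = {1..length y})"

definition cover_lengths :: "'a list \<Rightarrow> nat set" where
  "cover_lengths u = {length w | w. is_cover w u}"

text \<open>\<open>cover_lengths u\<close> is finite, since covers of \<open>u\<close> are shorter than \<open>u\<close>.\<close>

definition min_cover_array :: "'a list \<Rightarrow> nat \<Rightarrow> nat" where
  "min_cover_array y i =
    (let L = cover_lengths (take i y) in if L = {} then 0 else Min L)"

definition max_cover_array :: "'a list \<Rightarrow> nat \<Rightarrow> nat" where
  "max_cover_array y i =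
    (let L = cover_lengths (take i y) in if L = {} then 0 else Max L)"

text \<open>A string uses only finitely many letters, so the alphabet \<open>nat\<close> already yields the cover
  arrays of strings over all alphabets.\<close>

definition valid_cover_array :: "nat \<Rightarrow> (nat \<Rightarrow> nat) \<Rightarrow> bool" where
  "valid_cover_array n C \<longleftrightarrow>
    (\<exists>y :: nat list. length y = n \<and>
      ((\<forall>i\<in>{1..n}. C i = min_cover_array y i) \<or>
       (\<forall>i\<in>{1..n}. C i = max_cover_array y i)))"

definition is_border :: "'a list \<Rightarrow> 'a list \<Rightarrow> bool" where
  "is_border v u \<longleftrightarrow> strict_prefix v u \<and> suffix v u"

definition longest_border :: "'a list \<Rightarrow> nat" where
  "longest_border u = Max {length v | v. is_border v u}"


section \<open>What Algorithm SIMA computes\<close>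

definition max_to_min :: "nat \<Rightarrow> (nat \<Rightarrow> nat) \<Rightarrow> (nat \<Rightarrow> nat)" where
  "max_to_min n =
    fold (\<lambda>i C. if C i \<noteq> 0 \<and> C (C i) \<noteq> 0 then C(i := C (C i)) else C) [1..<n + 1]"

text \<open>Truncated subtraction on \<open>nat\<close> expresses \<open>max 0 (max l (C i) - 1)\<close>.\<close>

definition prune_step :: "nat \<Rightarrow> (nat \<Rightarrow> nat) \<times> nat \<Rightarrow> (nat \<Rightarrow> nat) \<times> nat" where
  "prune_step i = (\<lambda>(C, l).
    let C' = (if l \<ge> C i then C(i := 0) else C) in (C', max l (C' i) - 1))"

definition prune :: "nat \<Rightarrow> (nat \<Rightarrow> nat) \<Rightarrow> (nat \<Rightarrow> nat)" where
  "prune n C = fst (fold prune_step (rev [1..<n + 1]) (C, 0))"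

definition edge_rel :: "nat \<Rightarrow> (nat \<Rightarrow> nat) \<Rightarrow> (nat \<times> nat) set" where
  "edge_rel n C = {(u, v). \<exists>i\<in>{1..n}. \<exists>j\<in>{1..C i}. {u, v} = {j, i - C i + j}}"

definition component :: "nat \<Rightarrow> (nat \<Rightarrow> nat) \<Rightarrow> nat \<Rightarrow> nat set" where
  "component n C i = {p \<in> {1..n}. (i, p) \<in> (edge_rel n C)\<^sup>*}"

datatype letter = La | Lb

definition choose_letter :: "(nat \<Rightarrow> letter option) \<Rightarrow> nat \<Rightarrow> letter" where
  "choose_letter x i =
    (if i = 1 then La
     else let B = longest_border (map (\<lambda>p. the (x p)) [1..<i])
          in if x (B + 1) = Some La then Lb else La)"

definition infer_step ::
  "nat \<Rightarrow> (nat \<Rightarrow> nat) \<Rightarrow> nat \<Rightarrow> (nat \<Rightarrow> letter option) \<Rightarrow> (nat \<Rightarrow> letter option)" where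
  "infer_step n C i x =
    (if x i = None
     then (\<lambda>p. if p \<in> component n C i then Some (choose_letter x i) else x p)
     else x)"

definition infer :: "nat \<Rightarrow> (nat \<Rightarrow> nat) \<Rightarrow> letter list" where
  "infer n C = map (\<lambda>p. the (fold (infer_step n C) [1..<n + 1] (\<lambda>_. None) p)) [1..<n + 1]"

definition sima :: "nat \<Rightarrow> (nat \<Rightarrow> nat) \<Rightarrow> letter list" where
  "sima n C = infer n (prune n (max_to_min n C))"


section \<open>Machine model\<close>

text \<open>An imperative language over natural-number variables and arrays, with the unit-cost measure
  of a random access machine: every operator, literal, variable access, array access, assignment
  and branch costs one step. The only arithmetic is addition and truncated subtraction.
  \<open>And\<close> evaluates, and is charged for, both arguments.\<close>

datatype var = vN | vI | vJ | vK | vE | vL | vC | vU | vV | vTop | vB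

datatype arr = Cov | Txt | Head | Next | Target | Stack | Bord

record state =
  vars :: "var \<Rightarrow> nat"
  arrs :: "arr \<Rightarrow> nat \<Rightarrow> nat"

datatype aexp =
    N nat
  | V var
  | Read arr aexp  ("_\<langle>_\<rangle>" [1000, 0] 999)
  | Plus aexp aexp  (infixl "\<oplus>" 65)
  | Minus aexp aexp  (infixl "\<ominus>" 65)

datatype bexp =
    Eq aexp aexp  (infix "\<doteq>" 50)
  | Less aexp aexp  (infix "\<prec>" 50)
  | Not bexp
  | And bexp bexp  (infixr "\<sqinter>" 35)

datatype com =
    Skip
  | Assign var aexp  ("_ ::= _" [1000, 61] 61)
  | Write arr aexp aexp  ("_\<langle>_\<rangle> ::= _" [1000, 0, 61] 61)
  | Seq com com  ("_;;/ _" [60, 61] 60)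
  | If bexp com com  ("(IF _/ THEN _/ ELSE _)" [0, 0, 61] 61)
  | While bexp com  ("(WHILE _/ DO _)" [0, 61] 61)

abbreviation Neq :: "aexp \<Rightarrow> aexp \<Rightarrow> bexp"  (infix "\<noteq>\<^sub>e" 50) where
  "a \<noteq>\<^sub>e b \<equiv> Not (a \<doteq> b)"

abbreviation Leq :: "aexp \<Rightarrow> aexp \<Rightarrow> bexp"  (infix "\<preceq>" 50) where
  "a \<preceq> b \<equiv> Not (b \<prec> a)"

fun aval :: "aexp \<Rightarrow> state \<Rightarrow> nat" where
  "aval (N k) s = k"
| "aval (V x) s = vars s x"
| "aval (Read A a) s = arrs s A (aval a s)"
| "aval (Plus a b) s = aval a s + aval b s"
| "aval (Minus a b) s = aval a s - aval b s"

fun bval :: "bexp \<Rightarrow> state \<Rightarrow> bool" where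
  "bval (Eq a b) s \<longleftrightarrow> aval a s = aval b s"
| "bval (Less a b) s \<longleftrightarrow> aval a s < aval b s"
| "bval (Not b) s \<longleftrightarrow> \<not> bval b s"
| "bval (And b c) s \<longleftrightarrow> bval b s \<and> bval c s"

fun acost :: "aexp \<Rightarrow> nat" where
  "acost (N k) = 1"
| "acost (V x) = 1"
| "acost (Read A a) = 1 + acost a"
| "acost (Plus a b) = 1 + acost a + acost b"
| "acost (Minus a b) = 1 + acost a + acost b"

fun bcost :: "bexp \<Rightarrow> nat" where
  "bcost (Eq a b) = 1 + acost a + acost b"
| "bcost (Less a b) = 1 + acost a + acost b"
| "bcost (Not b) = 1 + bcost b"
| "bcost (And b c) = 1 + bcost b + bcost c"

definition set_var :: "var \<Rightarrow> nat \<Rightarrow> state \<Rightarrow> state" where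
  "set_var x k s = s\<lparr>vars := (vars s)(x := k)\<rparr>"

definition set_arr :: "arr \<Rightarrow> nat \<Rightarrow> nat \<Rightarrow> state \<Rightarrow> state" where
  "set_arr A i k s = s\<lparr>arrs := (arrs s)(A := (arrs s A)(i := k))\<rparr>"

text \<open>\<open>exec c s t s'\<close>: started in \<open>s\<close>, \<open>c\<close> terminates in \<open>s'\<close> after exactly \<open>t\<close> steps.
  The language is deterministic, so \<open>t\<close> and \<open>s'\<close> are determined by \<open>c\<close> and \<open>s\<close>.\<close>

inductive exec :: "com \<Rightarrow> state \<Rightarrow> nat \<Rightarrow> state \<Rightarrow> bool" where
  Skip: "exec Skip s 1 s"
| Assign: "exec (Assign x a) s (1 + acost a) (set_var x (aval a s) s)"
| Write: "exec (Write A a b) s (1 + acost a + acost b) (set_arr A (aval a s) (aval b s) s)"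
| Seq: "exec c s t s' \<Longrightarrow> exec d s' t' s'' \<Longrightarrow> exec (Seq c d) s (t + t') s''"
| IfTrue: "bval b s \<Longrightarrow> exec c s t s' \<Longrightarrow> exec (If b c d) s (1 + bcost b + t) s'"
| IfFalse: "\<not> bval b s \<Longrightarrow> exec d s t s' \<Longrightarrow> exec (If b c d) s (1 + bcost b + t) s'"
| WhileFalse: "\<not> bval b s \<Longrightarrow> exec (While b c) s (1 + bcost b) s"
| WhileTrue: "bval b s \<Longrightarrow> exec c s t s' \<Longrightarrow> exec (While b c) s' t' s'' \<Longrightarrow>
    exec (While b c) s (1 + bcost b + t + t') s''"


section \<open>The implementation of Algorithm SIMA\<close>

definition max_to_min_com :: com where
  "max_to_min_com =
    vI ::= N 1;;
    WHILE V vI \<preceq> V vN DO (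
      IF Cov\<langle>V vI\<rangle> \<noteq>\<^sub>e N 0 \<sqinter> Cov\<langle>Cov\<langle>V vI\<rangle>\<rangle> \<noteq>\<^sub>e N 0
      THEN Cov\<langle>V vI\<rangle> ::= Cov\<langle>Cov\<langle>V vI\<rangle>\<rangle>
      ELSE Skip;;
      vI ::= V vI \<oplus> N 1)"

definition prune_com :: com where
  "prune_com =
    vL ::= N 0;;
    vI ::= V vN;;
    WHILE N 1 \<preceq> V vI DO (
      IF Cov\<langle>V vI\<rangle> \<preceq> V vL THEN Cov\<langle>V vI\<rangle> ::= N 0 ELSE Skip;;
      IF V vL \<prec> Cov\<langle>V vI\<rangle> THEN vL ::= Cov\<langle>V vI\<rangle> ELSE Skip;;
      vL ::= V vL \<ominus> N 1;;
      vI ::= V vI \<ominus> N 1)"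

text \<open>Adjacency lists: \<open>Head\<langle>v\<rangle>\<close> is the first cell of the list of \<open>v\<close>; a cell \<open>e\<close> holds the
  neighbour \<open>Target\<langle>e\<rangle>\<close> and the successor cell \<open>Next\<langle>e\<rangle>\<close>; 0 is the null cell. In \<open>Txt\<close>, 0 marks
  an unassigned position.\<close>

definition init_com :: com where
  "init_com =
    vI ::= N 1;;
    WHILE V vI \<preceq> V vN DO (
      Head\<langle>V vI\<rangle> ::= N 0;;
      Txt\<langle>V vI\<rangle> ::= N 0;;
      vI ::= V vI \<oplus> N 1)"

definition add_arc_com :: "var \<Rightarrow> var \<Rightarrow> com" where
  "add_arc_com u v =
    vE ::= V vE \<oplus> N 1;;
    Target\<langle>V vE\<rangle> ::= V v;;
    Next\<langle>V vE\<rangle> ::= Head\<langle>V u\<rangle>;;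
    Head\<langle>V u\<rangle> ::= V vE"

definition build_graph_com :: com where
  "build_graph_com =
    vE ::= N 0;;
    vI ::= N 1;;
    WHILE V vI \<preceq> V vN DO (
      vJ ::= N 1;;
      WHILE V vJ \<preceq> Cov\<langle>V vI\<rangle> DO (
        vK ::= (V vI \<ominus> Cov\<langle>V vI\<rangle>) \<oplus> V vJ;;
        add_arc_com vJ vK;;
        add_arc_com vK vJ;;
        vJ ::= V vJ \<oplus> N 1);;
      vI ::= V vI \<oplus> N 1)"

fun code :: "letter \<Rightarrow> nat" where
  "code La = 1"
| "code Lb = 2"

definition choose_letter_com :: com where
  "choose_letter_com =
    (IF V vI \<doteq> N 1 THEN vC ::= N (code La)
     ELSE IF Txt\<langle>Bord\<langle>V vI \<ominus> N 1\<rangle> \<oplus> N 1\<rangle> \<doteq> N (code La) THEN vC ::= N (code Lb)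
     ELSE vC ::= N (code La))"

text \<open>Depth-first search from \<open>vI\<close>, writing the letter \<open>vC\<close> at every position it discovers.
  Each adjacency list is scanned only once, so \<open>Head\<langle>v\<rangle>\<close> itself serves as the scan pointer.\<close>

definition dfs_com :: com where
  "dfs_com =
    Txt\<langle>V vI\<rangle> ::= V vC;;
    vTop ::= N 1;;
    Stack\<langle>V vTop\<rangle> ::= V vI;;
    WHILE N 1 \<preceq> V vTop DO (
      vV ::= Stack\<langle>V vTop\<rangle>;;
      vE ::= Head\<langle>V vV\<rangle>;;
      IF V vE \<doteq> N 0 THEN vTop ::= V vTop \<ominus> N 1
      ELSE (
        Head\<langle>V vV\<rangle> ::= Next\<langle>V vE\<rangle>;;
        vU ::= Target\<langle>V vE\<rangle>;;
        IF Txt\<langle>V vU\<rangle> \<doteq> N 0 THEN (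
          Txt\<langle>V vU\<rangle> ::= V vC;;
          vTop ::= V vTop \<oplus> N 1;;
          Stack\<langle>V vTop\<rangle> ::= V vU)
        ELSE Skip))"

text \<open>The failure function: sets \<open>Bord\<langle>vI\<rangle>\<close> from \<open>Bord\<langle>1\<rangle>, \<dots>, Bord\<langle>vI - 1\<rangle>\<close>.\<close>

definition border_com :: com where
  "border_com =
    (IF V vI \<doteq> N 1 THEN Bord\<langle>V vI\<rangle> ::= N 0
     ELSE (
       vB ::= Bord\<langle>V vI \<ominus> N 1\<rangle>;;
       WHILE N 1 \<preceq> V vB \<sqinter> Txt\<langle>V vB \<oplus> N 1\<rangle> \<noteq>\<^sub>e Txt\<langle>V vI\<rangle> DO vB ::= Bord\<langle>V vB\<rangle>;;
       IF Txt\<langle>V vB \<oplus> N 1\<rangle> \<doteq> Txt\<langle>V vI\<rangle> THEN vB ::= V vB \<oplus> N 1 ELSE Skip;;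
       Bord\<langle>V vI\<rangle> ::= V vB))"

definition infer_com :: com where
  "infer_com =
    init_com;;
    build_graph_com;;
    vI ::= N 1;;
    WHILE V vI \<preceq> V vN DO (
      IF Txt\<langle>V vI\<rangle> \<doteq> N 0 THEN (choose_letter_com;; dfs_com) ELSE Skip;;
      border_com;;
      vI ::= V vI \<oplus> N 1)"

definition sima_com :: com where
  "sima_com = max_to_min_com;; prune_com;; infer_com"

text \<open>Everything but the input is left arbitrary: the program has to initialise, and pay for, the
  variables and arrays it uses.\<close>

definition holds_input :: "nat \<Rightarrow> (nat \<Rightarrow> nat) \<Rightarrow> state \<Rightarrow> bool" where
  "holds_input n C s \<longleftrightarrow> vars s vN = n \<and> (\<forall>i\<in>{1..n}. arrs s Cov i = C i)"

definition holds_output :: "letter list \<Rightarrow> state \<Rightarrow> bool" where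
  "holds_output x s \<longleftrightarrow> map (arrs s Txt) [1..<length x + 1] = map code x"

end

theory Submission
  imports Defs
begin

text \<open>The only non-routine point is that the graph has \<open>O(n)\<close> edges, i.e. that the pruned array
  has sum at most \<open>2 n\<close>. After pruning, the intervals \<open>{i - C i<..i}\<close> with \<open>C i \<noteq> 0\<close> form an
  antichain. If such an interval meets a later one, the overlap is a prefix of the string (since the
  later interval holds a cover) and a suffix of the minimal cover of the prefix of length \<open>i\<close>, hence
  a border of that cover. A border of at least half the length would itself be a cover, and a shorter
  one. So at most half of each interval lies in later ones, and the lengths add up to at
  most \<open>2 n\<close>. The remaining costs are amortised: a search step scans a list cell, assigns a letter or
  pops the stack, and every iteration of the failure-function loop shortens the current border.\<close>

section \<open>Executing programs with time credits\<close>

text \<open>Step 1 matters for the running time: the overlap argument uses minimality of the covers,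
  so a maximal-cover array must first become the minimal one. This works because a cover of a cover
  is a cover and, of two covers of one string, the shorter covers the longer. Time and output are
  verified by the same invariants, since the charges depend on what the arrays hold: which list
  cells are left, and that a stored border is shorter than its prefix. \<open>run\<close> therefore
  joins total correctness with credits, and \<open>Q\<close> receives the unspent credit. Potentials
  appear as lower bounds on that credit, so what one search or one border computation does not use
  is handed to the next. The constants are rounded up.\<close>

definition run :: "com \<Rightarrow> nat \<Rightarrow> state \<Rightarrow> (nat \<Rightarrow> state \<Rightarrow> bool) \<Rightarrow> bool" where
  "run c m s Q \<longleftrightarrow> (\<exists>t s'. exec c s t s' \<and> t \<le> m \<and> Q (m - t) s')"

inductive_cases SkipE: "exec Skip s t s'"
inductive_cases AssignE: "exec (Assign x a) s t s'"
inductive_cases WriteE: "exec (Write A a b) s t s'"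
inductive_cases SeqE: "exec (Seq c d) s t s'"

lemma run_Skip: "run Skip m s Q \<longleftrightarrow> 1 \<le> m \<and> Q (m - 1) s"
  unfolding run_def by (metis SkipE exec.Skip)

lemma run_Assign:
  "run (Assign x a) m s Q \<longleftrightarrow> 1 + acost a \<le> m \<and> Q (m - (1 + acost a)) (set_var x (aval a s) s)"
  unfolding run_def
  by (metis AssignE exec.Assign)

lemma run_Write:
  "run (Write A a b) m s Q \<longleftrightarrow> 1 + acost a + acost b \<le> m \<and>
     Q (m - (1 + acost a + acost b)) (set_arr A (aval a s) (aval b s) s)"
  unfolding run_def
  by (metis WriteE exec.Write)

text \<open>An equation rather than a rule: the second command becomes part of the postcondition of
  the first, so rewriting alone executes straight-line code and collects the credit
  conditions.\<close>

lemma run_Seq: "run (Seq c d) m s Q \<longleftrightarrow> run c m s (\<lambda>m' s'. run d m' s' Q)"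
proof
  assume "run (Seq c d) m s Q"
  then show "run c m s (\<lambda>m' s'. run d m' s' Q)"
    unfolding run_def
    by (elim exE conjE SeqE) (metis add_leD1 diff_diff_left le_diff_conv2 add.commute)
next
  assume "run c m s (\<lambda>m' s'. run d m' s' Q)"
  then obtain t s' t' s'' where *: "exec c s t s'" "t \<le> m" "exec d s' t' s''" "t' \<le> m - t"
    "Q (m - t - t') s''"
    unfolding run_def by blast
  then show "run (Seq c d) m s Q"
    unfolding run_def
    by (intro exI[of _ "t + t'"] exI[of _ s'']) (auto intro: exec.Seq)
qed

lemma run_If:
  "run (If b c d) m s Q \<longleftrightarrow> 1 + bcost b \<le> m \<and>
     (if bval b s then run c (m - (1 + bcost b)) s Q else run d (m - (1 + bcost b)) s Q)"
proof -
  define e where "e = (if bval b s then c else d)"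
  have "run (If b c d) m s Q \<longleftrightarrow> 1 + bcost b \<le> m \<and> run e (m - (1 + bcost b)) s Q"
  proof
    assume "run (If b c d) m s Q"
    then obtain t s' where t: "exec (If b c d) s t s'" "t \<le> m" "Q (m - t) s'"
      unfolding run_def by blast
    from t(1) obtain t' where "t = 1 + bcost b + t'" "exec e s t' s'"
      by (cases rule: exec.cases) (auto simp: e_def)
    with t show "1 + bcost b \<le> m \<and> run e (m - (1 + bcost b)) s Q"
      unfolding run_def by (intro conjI exI[of _ t'] exI[of _ s']) auto
  next
    assume R: "1 + bcost b \<le> m \<and> run e (m - (1 + bcost b)) s Q"
    then obtain t' s' where t: "exec e s t' s'" "t' \<le> m - (1 + bcost b)"
      "Q (m - (1 + bcost b) - t') s'"
      unfolding run_def by blast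
    then have "exec (If b c d) s (1 + bcost b + t') s'"
      using exec.IfTrue[of b s c t' s' d] exec.IfFalse[of b s d t' s' c]
      by (cases "bval b s") (simp_all add: e_def)
    with t R show "run (If b c d) m s Q"
      unfolding run_def by (intro exI[of _ "1 + bcost b + t'"] exI[of _ s']) auto
  qed
  then show ?thesis by (simp add: e_def)
qed

text \<open>No separate termination measure is needed: every iteration consumes credit.\<close>

lemma run_While:
  assumes init: "I m s"
    and cost: "\<And>m s. I m s \<Longrightarrow> 1 + bcost b \<le> m"
    and step: "\<And>m s. I m s \<Longrightarrow> bval b s \<Longrightarrow> run c (m - (1 + bcost b)) s I"
    and exit: "\<And>m s. I m s \<Longrightarrow> \<not> bval b s \<Longrightarrow> Q (m - (1 + bcost b)) s"
  shows "run (While b c) m s Q"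
  using init
proof (induction m arbitrary: s rule: less_induct)
  case (less m)
  have m: "1 + bcost b \<le> m" using cost less.prems .
  show ?case
  proof (cases "bval b s")
    case False
    then show ?thesis
      unfolding run_def using m exit[OF less.prems False] exec.WhileFalse[OF False] by blast
  next
    case True
    from step[OF less.prems True] obtain t s' where t: "exec c s t s'" "t \<le> m - (1 + bcost b)"
      "I (m - (1 + bcost b) - t) s'"
      unfolding run_def by blast
    then have "run (While b c) (m - (1 + bcost b) - t) s' Q"
      using less.IH[of "m - (1 + bcost b) - t" s'] m by auto
    then obtain t' s'' where t': "exec (While b c) s' t' s''" "t' \<le> m - (1 + bcost b) - t"
      "Q (m - (1 + bcost b) - t - t') s''"
      unfolding run_def by blast
    have "exec (While b c) s (1 + bcost b + t + t') s''"
      using exec.WhileTrue[OF True t(1) t'(1)] .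
    with t t' m show ?thesis
      unfolding run_def by (intro exI[of _ "1 + bcost b + t + t'"] exI[of _ s'']) auto
  qed
qed

text \<open>As a congruence rule, this makes the simplifier execute a program from its first command on
  instead of descending into the continuation \<open>Q\<close>.\<close>

lemma run_cong [cong]: "m = m' \<Longrightarrow> s = s' \<Longrightarrow> run c m s Q = run c m' s' Q"
  by simp

lemmas run_simps = run_Skip run_Assign run_Write run_Seq run_If set_var_def set_arr_def

section \<open>Covers and the size of the pruned array\<close>

text \<open>Positions are 0-based here, and \<open>m = k\<close> is allowed.\<close>

definition covers :: "(nat \<Rightarrow> 'a) \<Rightarrow> nat \<Rightarrow> nat \<Rightarrow> bool" where
  "covers f m k \<longleftrightarrow>
    (\<forall>p<k. \<exists>q\<le>p. p < q + m \<and> q + m \<le> k \<and> (\<forall>r<m. f (q + r) = f r))"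

lemma coversD:
  assumes "covers f m k" "p < k"
  obtains q where "q \<le> p" "p < q + m" "q + m \<le> k" "\<And>r. r < m \<Longrightarrow> f (q + r) = f r"
  using assms unfolding covers_def by blast

section \<open>Composing and comparing covers\<close>

text \<open>Inside each occurrence of the prefix of length \<open>b\<close>, the occurrences of the
  prefix of length \<open>a\<close> are repeated at the same offsets.\<close>

lemma covers_trans:
  assumes "covers f a b" "covers f b k" shows "covers f a k"
  unfolding covers_def
proof (intro allI impI)
  fix p assume "p < k"
  with assms(2) obtain q where q: "q \<le> p" "p < q + b" "q + b \<le> k" "\<And>r. r < b \<Longrightarrow> f (q + r) = f r"
    by (rule coversD) auto
  have "p - q < b" using q by auto
  with assms(1) obtain q' where q': "q' \<le> p - q" "p - q < q' + a" "q' + a \<le> b"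
    "\<And>r. r < a \<Longrightarrow> f (q' + r) = f r"
    by (rule coversD) auto
  have "f (q + q' + r) = f r" if "r < a" for r
    using q(4)[of "q' + r"] q'(3,4) that by (simp add: add.assoc)
  then show "\<exists>q\<le>p. p < q + a \<and> q + a \<le> k \<and> (\<forall>r<a. f (q + r) = f r)"
    using q q' by (intro exI[of _ "q + q'"]) auto
qed

text \<open>The last position forces an occurrence that ends exactly at \<open>k\<close>.\<close>

lemma covers_suffix:
  assumes "covers f m k" "r < m" "m \<le> k" shows "f (k - m + r) = f r"
proof -
  have "k - 1 < k" using assms by auto
  with assms(1) obtain q where q: "q \<le> k - 1" "k - 1 < q + m" "q + m \<le> k"
    "\<And>r. r < m \<Longrightarrow> f (q + r) = f r"
    by (rule coversD) auto
  have "q = k - m" using q by auto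
  with q assms show ?thesis by auto
qed

text \<open>Occurrences that stay within the first \<open>b\<close> positions are kept; one that
  sticks out is replaced by the occurrence ending at \<open>b\<close>.\<close>

lemma covers_shorter:
  assumes "covers f a k" "covers f b k" "a \<le> b" "b \<le> k" shows "covers f a b"
  unfolding covers_def
proof (intro allI impI)
  fix p assume p: "p < b"
  then have "p < k" using assms by auto
  with assms(1) obtain q where q: "q \<le> p" "p < q + a" "q + a \<le> k" "\<And>r. r < a \<Longrightarrow> f (q + r) = f r"
    by (rule coversD) auto
  show "\<exists>q\<le>p. p < q + a \<and> q + a \<le> b \<and> (\<forall>r<a. f (q + r) = f r)"
  proof (cases "q + a \<le> b")
    case True
    with q show ?thesis by blast
  next
    case False
    \<comment> \<open>Both prefixes are suffixes of the prefix of length \<open>k\<close>, so the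
      one of length \<open>a\<close> is also a suffix of the one of length \<open>b\<close>.\<close>
    have "f (b - a + r) = f r" if "r < a" for r
      using covers_suffix[OF assms(1), of r] covers_suffix[OF assms(2), of "b - a + r"] assms that
      by simp
    with False q p assms show ?thesis by (intro exI[of _ "b - a"]) auto
  qed
qed

text \<open>The occurrences of the border at the two ends leave no gap when
  \<open>u \<le> 2 * z\<close>.\<close>

lemma covers_of_long_border:
  assumes "\<And>r. r < z \<Longrightarrow> f (u - z + r) = f r" "z \<le> u" "u \<le> 2 * z" shows "covers f z u"
  unfolding covers_def
proof (intro allI impI)
  fix p assume p: "p < u"
  show "\<exists>q\<le>p. p < q + z \<and> q + z \<le> u \<and> (\<forall>r<z. f (q + r) = f r)"
  proof (cases "p < z")
    case True
    with assms show ?thesis by (intro exI[of _ 0]) auto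
  next
    case False
    with assms p show ?thesis by (intro exI[of _ "u - z"]) auto
  qed
qed

section \<open>From lists and sets of occurrences to index arithmetic\<close>

lemma factor_eq_iff:
  assumes "q + length w \<le> length y"
  shows "factor y (Suc q) (length w) = w \<longleftrightarrow> (\<forall>r<length w. y ! (q + r) = w ! r)"
  using assms by (auto simp: factor_def list_eq_iff_nth_eq)

text \<open>Covering the first position forces \<open>w\<close> to be a prefix of \<open>y\<close>,
  so a cover is determined by its length and only \<open>y\<close> itself is left to reason
  about.\<close>

lemma is_cover_iff:
  "is_cover w y \<longleftrightarrow> length w < length y \<and> w = take (length w) y \<and> covers ((!) y) (length w) (length y)"
  (is "_ \<longleftrightarrow> ?R")
proof
  assume "is_cover w y"
  then obtain P where P: "length w < length y" "P \<subseteq> {1..length y - length w + 1}"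
    "\<forall>p\<in>P. factor y p (length w) = w" "(\<Union>p\<in>P. {p..<p + length w}) = {1..length y}"
    unfolding is_cover_def by blast
  have ex: "\<exists>q\<le>k. k < q + length w \<and> q + length w \<le> length y \<and> (\<forall>r<length w. y ! (q + r) = w ! r)"
    if "k < length y" for k
  proof -
    have "Suc k \<in> (\<Union>p\<in>P. {p..<p + length w})" using that P(4) by auto
    then obtain p where p: "p \<in> P" "p \<le> Suc k" "Suc k < p + length w" by auto
    with P(2) have "1 \<le> p" "p + length w \<le> length y + 1" using P(1) by force+
    with p obtain q where "p = Suc q" "q + length w \<le> length y" by (cases p) auto
    with p P(3) factor_eq_iff[of q w y] show ?thesis by (intro exI[of _ q]) auto
  qed
  have "0 < length y" using P(1) by linarith
  from ex[OF this] have pre: "\<forall>r<length w. y ! r = w ! r" by auto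
  then have "w = take (length w) y" using P(1) by (auto simp: list_eq_iff_nth_eq)
  moreover have "covers ((!) y) (length w) (length y)"
    unfolding covers_def using ex pre by fastforce
  ultimately show ?R using P(1) by blast
next
  assume R: ?R
  \<comment> \<open>The set of all occurrences is the largest candidate for
    \<open>P\<close>.\<close>
  define P where "P = {Suc q |q. q + length w \<le> length y \<and> (\<forall>r<length w. y ! (q + r) = y ! r)}"
  have pre: "\<forall>r<length w. y ! r = w ! r" using R by (metis nth_take)
  have 1: "P \<subseteq> {1..length y - length w + 1}" unfolding P_def by auto
  have 2: "\<forall>p\<in>P. factor y p (length w) = w"
    unfolding P_def using pre by (auto simp: factor_eq_iff)
  have "{1..length y} \<subseteq> (\<Union>p\<in>P. {p..<p + length w})"
  proof
    fix k assume k: "k \<in> {1..length y}"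
    then have "k - 1 < length y" by auto
    with R obtain q where q: "q \<le> k - 1" "k - 1 < q + length w" "q + length w \<le> length y"
      "\<And>r. r < length w \<Longrightarrow> y ! (q + r) = y ! r"
      by (auto elim: coversD)
    then have "Suc q \<in> P" unfolding P_def by auto
    with q k show "k \<in> (\<Union>p\<in>P. {p..<p + length w})" by (intro UN_I[of "Suc q"]) auto
  qed
  moreover have "(\<Union>p\<in>P. {p..<p + length w}) \<subseteq> {1..length y}" unfolding P_def by auto
  ultimately show "is_cover w y" unfolding is_cover_def using R 1 2 by blast
qed

lemma covers_cong:
  assumes "\<And>i. i < k \<Longrightarrow> f i = g i" "m \<le> k" shows "covers f m k = covers g m k"
proof -
  have "f (q + r) = f r \<longleftrightarrow> g (q + r) = g r" if "q + m \<le> k" "r < m" for q r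
    using that assms by simp
  then show ?thesis unfolding covers_def by (metis (no_types, lifting))
qed

lemma cover_lengths_take:
  assumes "k \<le> length y"
  shows "cover_lengths (take k y) = {m. m < k \<and> covers ((!) y) m k}"
proof -
  have "is_cover w (take k y) \<longleftrightarrow> length w < k \<and> w = take (length w) y \<and> covers ((!) y) (length w) k"
    for w
    using assms covers_cong[of k "(!) (take k y)" "(!) y" "length w"]
    by (auto simp: is_cover_iff min_def)
  moreover have "\<exists>w. m = length w \<and> length w < k \<and> w = take (length w) y \<and> covers ((!) y) (length w) k"
    if "m < k" "covers ((!) y) m k" for m
    using that assms by (intro exI[of _ "take m y"]) (auto simp: min_def)
  ultimately show ?thesis unfolding cover_lengths_def by auto
qed

section \<open>Cover arrays of a fixed string\<close>

context
  fixes y :: "'a list"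
begin

abbreviation "proper_cover m k \<equiv> m < k \<and> covers ((!) y) m k"

text \<open>The empty string covers no position, so the value 0 unambiguously signals that there is
  no cover.\<close>

lemma min_cover_array_cases [consumes 1]:
  assumes "k \<le> length y"
  obtains (None) "min_cover_array y k = 0" "\<And>m. \<not> proper_cover m k"
  | (Some) "min_cover_array y k > 0" "proper_cover (min_cover_array y k) k"
      "\<And>m. proper_cover m k \<Longrightarrow> min_cover_array y k \<le> m"
proof (cases "cover_lengths (take k y) = {}")
  case True
  with that(1) cover_lengths_take[OF assms] show ?thesis
    by (auto simp: min_cover_array_def)
next
  case False
  have fin: "finite (cover_lengths (take k y))" using cover_lengths_take[OF assms] by simp
  from False have eq: "min_cover_array y k = Min (cover_lengths (take k y))"
    by (simp add: min_cover_array_def)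
  have pc: "proper_cover (min_cover_array y k) k"
    using Min_in[OF fin False] cover_lengths_take[OF assms] eq by auto
  then have "min_cover_array y k > 0"
    unfolding covers_def by (metis add.right_neutral leD zero_less_iff_neq_zero less_nat_zero_code)
  with pc show ?thesis using that(2) Min_le[OF fin] cover_lengths_take[OF assms] eq by auto
qed

lemma max_cover_array_cases [consumes 1]:
  assumes "k \<le> length y"
  obtains (None) "max_cover_array y k = 0" "\<And>m. \<not> proper_cover m k"
  | (Some) "max_cover_array y k > 0" "proper_cover (max_cover_array y k) k"
      "\<And>m. proper_cover m k \<Longrightarrow> m \<le> max_cover_array y k"
proof (cases "cover_lengths (take k y) = {}")
  case True
  with that(1) cover_lengths_take[OF assms] show ?thesis
    by (auto simp: max_cover_array_def)
next
  case False
  have fin: "finite (cover_lengths (take k y))" using cover_lengths_take[OF assms] by simp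
  from False have eq: "max_cover_array y k = Max (cover_lengths (take k y))"
    by (simp add: max_cover_array_def)
  have pc: "proper_cover (max_cover_array y k) k"
    using Max_in[OF fin False] cover_lengths_take[OF assms] eq by auto
  then have "max_cover_array y k > 0"
    unfolding covers_def by (metis add.right_neutral leD zero_less_iff_neq_zero less_nat_zero_code)
  with pc show ?thesis using that(2) Max_ge[OF fin] cover_lengths_take[OF assms] eq by auto
qed

lemma min_cover_array_less: "1 \<le> k \<Longrightarrow> k \<le> length y \<Longrightarrow> min_cover_array y k < k"
  by (cases rule: min_cover_array_cases[of k]) auto

text \<open>A cover of the minimal cover would by transitivity be a shorter cover of the whole
  prefix. Hence Step 1 leaves a minimal-cover array unchanged.\<close>

lemma min_cover_array_min:
  assumes "k \<le> length y" shows "min_cover_array y (min_cover_array y k) = 0"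
  using assms
proof (cases rule: min_cover_array_cases)
  case None
  then show ?thesis by (simp add: min_cover_array_def cover_lengths_def is_cover_def)
next
  case Some
  let ?m = "min_cover_array y k"
  have "?m \<le> length y" using Some assms by auto
  then show ?thesis
  proof (cases rule: min_cover_array_cases)
    case S: Some
    then have "proper_cover (min_cover_array y ?m) k"
      using Some covers_trans[of _ _ ?m k] by auto
    with Some(3) S show ?thesis by fastforce
  qed auto
qed

text \<open>The right-hand side is the update of Step 1 at a position whose predecessors already
  hold minimal covers. The minimal cover of the prefix covers the longest cover \<open>M\<close> by
  \<open>covers_shorter\<close>, and every cover of \<open>M\<close> covers the prefix; so both have
  the same minimal cover, unless \<open>M\<close> has no shorter one and is itself minimal.\<close>

lemma min_cover_array_max:
  assumes "k \<le> length y"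
  shows "min_cover_array y k =
    (let M = max_cover_array y k
     in if M \<noteq> 0 \<and> min_cover_array y M \<noteq> 0 then min_cover_array y M else M)"
  using assms
proof (cases rule: max_cover_array_cases)
  case None
  then show ?thesis by (cases rule: min_cover_array_cases[OF assms]) auto
next
  case M: Some
  let ?M = "max_cover_array y k" and ?a = "min_cover_array y k"
  have a: "proper_cover ?a k" "\<And>m. proper_cover m k \<Longrightarrow> ?a \<le> m"
    using M min_cover_array_cases[OF assms] by metis+
  have ale: "?a \<le> ?M" using a M by auto
  have cov: "covers ((!) y) ?a ?M"
    using covers_shorter[of _ ?a k ?M] a M ale by auto
  have "?M \<le> length y" using M assms by auto
  then show ?thesis
  proof (cases rule: min_cover_array_cases)
    case None
    then have "?a = ?M" using cov ale by (metis nat_less_le)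
    with None show ?thesis by auto
  next
    case S: Some
    then have pc: "proper_cover (min_cover_array y ?M) k"
      using M covers_trans[of _ _ ?M k] by auto
    with a S have "?a < ?M" by fastforce
    with S(3) cov have "min_cover_array y ?M \<le> ?a" by auto
    with a(2)[OF pc] S(1) M(1) show ?thesis by (simp add: Let_def)
  qed
qed

text \<open>The two prefixes of \<open>y\<close> overlap in a border of the minimal cover of the shorter one; a border
  of at least half its length would be a shorter cover.\<close>

lemma min_cover_overlap:
  assumes ij: "i < j" "j \<le> length y"
    and pos: "min_cover_array y i \<noteq> 0" "min_cover_array y j \<noteq> 0"
    and starts: "i - min_cover_array y i < j - min_cover_array y j"
    and overlap: "j - min_cover_array y j < i"
  shows "2 * (i - (j - min_cover_array y j)) \<le> min_cover_array y i"
proof (rule ccontr)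
  let ?a = "min_cover_array y i" and ?b = "min_cover_array y j"
  define z where "z = i - (j - ?b)"
  assume "\<not> ?thesis"
  then have long: "?a \<le> 2 * z" by (simp add: z_def)
  have il: "i \<le> length y" using ij by auto
  have a: "proper_cover ?a i" "\<And>m. proper_cover m i \<Longrightarrow> ?a \<le> m"
    using pos min_cover_array_cases[OF il] by (metis gr_implies_not0)+
  have b: "proper_cover ?b j"
    using pos min_cover_array_cases[OF ij(2)] by metis
  have z: "z < ?a" "z < ?b" "j - ?b + z = i" using starts overlap a b ij by (auto simp: z_def)
  have "y ! (?a - z + r) = y ! r" if "r < z" for r
  proof -
    have "y ! (?a - z + r) = y ! (i - ?a + (?a - z + r))"
      by (rule covers_suffix[symmetric]) (use a z that in auto)
    \<comment> \<open>The same position of the overlap is read twice: as letter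
      \<open>?a - z + r\<close> of the cover ending at \<open>i\<close>, and as letter
      \<open>r\<close> of the cover starting at \<open>j - ?b\<close>.\<close>
    also have "i - ?a + (?a - z + r) = j - ?b + r" using z a that by auto
    also have "y ! (j - ?b + r) = y ! r"
      by (rule covers_suffix) (use b z that in auto)
    finally show ?thesis .
  qed
  then have "covers ((!) y) z ?a" using covers_of_long_border[of z _ ?a] z long by auto
  then have "proper_cover z i" using covers_trans[of _ z ?a i] a z by auto
  with a(2) z show False by fastforce
qed

end

section \<open>Effect of Step 1 on valid arrays\<close>

text \<open>The entry that the loop looks up lies strictly to the left, so it is already minimal;
  \<open>min_cover_array_min\<close> or \<open>min_cover_array_max\<close> then determines the
  update.\<close>

lemma max_to_min_valid:
  assumes C: "(\<forall>i\<in>{1..length y}. C i = min_cover_array y i) \<or>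
              (\<forall>i\<in>{1..length y}. C i = max_cover_array y i)"
    and i: "i \<in> {1..length y}"
  shows "max_to_min (length y) C i = min_cover_array y i"
proof -
  let ?step = "\<lambda>i C. if C i \<noteq> 0 \<and> C (C i) \<noteq> 0 then C(i := C (C i)) else (C :: nat \<Rightarrow> nat)"
  have "\<forall>j\<in>{1..length y}. fold ?step [1..<k + 1] C j = (if j \<le> k then min_cover_array y j else C j)"
    if "k \<le> length y" for k
    using that
  proof (induction k)
    case 0
    then show ?case by auto
  next
    case (Suc k)
    define D where "D = fold ?step [1..<k + 1] C"
    have IH: "D j = (if j \<le> k then min_cover_array y j else C j)" if "j \<in> {1..length y}" for j
      using Suc that D_def by auto
    have D': "fold ?step [1..<Suc k + 1] C = ?step (Suc k) D" unfolding D_def by simp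
    have DS: "D (Suc k) = C (Suc k)" using IH[of "Suc k"] Suc.prems by auto
    have kl: "Suc k \<le> length y" "Suc k \<in> {1..length y}" using Suc.prems by auto
    have "?step (Suc k) D (Suc k) = min_cover_array y (Suc k)"
      using C
    proof
      assume "\<forall>i\<in>{1..length y}. C i = min_cover_array y i"
      then have eq: "D (Suc k) = min_cover_array y (Suc k)" using DS kl by auto
      show ?thesis
      proof (cases "D (Suc k) = 0")
        case False
        have "D (Suc k) < Suc k" using eq min_cover_array_less[of "Suc k" y] kl by auto
        then have "D (D (Suc k)) = 0"
          using IH[of "D (Suc k)"] False kl min_cover_array_min[OF kl(1)] eq by auto
        then show ?thesis using eq by simp
      qed (use eq in simp)
    next
      assume "\<forall>i\<in>{1..length y}. C i = max_cover_array y i"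
      then have eq: "D (Suc k) = max_cover_array y (Suc k)" using DS kl by auto
      show ?thesis
      proof (cases "D (Suc k) = 0")
        case True
        then show ?thesis using min_cover_array_max[OF kl(1)] eq by (simp add: Let_def)
      next
        case False
        have "D (Suc k) < Suc k"
          using eq False by (cases rule: max_cover_array_cases[OF kl(1)]) auto
        then have "D (D (Suc k)) = min_cover_array y (D (Suc k))"
          using IH[of "D (Suc k)"] False kl by auto
        then show ?thesis using min_cover_array_max[OF kl(1)] eq False by (simp add: Let_def)
      qed
    qed
    moreover have "?step (Suc k) D j = D j" if "j \<noteq> Suc k" for j using that by auto
    ultimately show ?case unfolding D' using IH by (metis le_Suc_eq)
  qed
  from this[of "length y"] i show ?thesis unfolding max_to_min_def by auto
qed

section \<open>Total length of the intervals kept by Step 2\<close>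

text \<open>An entry is erased only when it is at most \<open>l\<close>, so the maximum may be taken
  with the old entry instead of the new one.\<close>

lemma prune_step_eq: "prune_step i (C, l) = (C(i := if C i \<le> l then 0 else C i), max l (C i) - 1)"
  by (auto simp: prune_step_def Let_def fun_eq_iff max_def)

lemma fold_prune_step_cong:
  assumes "\<And>i. i \<in> A \<Longrightarrow> C i = D i" "set xs \<subseteq> A" "i \<in> A"
  shows "fst (fold prune_step xs (C, l)) i = fst (fold prune_step xs (D, l)) i"
  using assms
proof (induction xs arbitrary: C D l)
  case (Cons x xs)
  have "C x = D x" using Cons.prems by auto
  then show ?case using Cons.prems
    by (auto simp: prune_step_eq intro!: Cons.IH)
qed auto

lemma prune_cong:
  assumes "\<And>i. i \<in> {1..n} \<Longrightarrow> C i = D i" "i \<in> {1..n}"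
  shows "prune n C i = prune n D i"
  unfolding prune_def using assms by (intro fold_prune_step_cong[of "{1..n}"]) auto

text \<open>When the loop of \<open>prune\<close> has processed the positions above \<open>i\<close>, the number \<open>i - l\<close> is the
  least left end of an interval \<open>{j - C j<..j}\<close> with \<open>j > i\<close>, or \<open>i\<close> if none reaches below \<open>i\<close>; by the overlap condition at least
  half of every retained interval lies to the left of all later ones.\<close>

lemma prune_bounds:
  assumes lt: "\<And>i. i \<in> {1..n} \<Longrightarrow> C i < i"
    and ov: "\<And>i j. 1 \<le> i \<Longrightarrow> i < j \<Longrightarrow> j \<le> n \<Longrightarrow> C i \<noteq> 0 \<Longrightarrow> C j \<noteq> 0 \<Longrightarrow>
      i - C i < j - C j \<Longrightarrow> j - C j < i \<Longrightarrow> 2 * (i - (j - C j)) \<le> C i"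
  shows "\<And>i. i \<in> {1..n} \<Longrightarrow> prune n C i < i"
    and "(\<Sum>i\<in>{1..n}. prune n C i) \<le> 2 * n"
proof -
  \<comment> \<open>The last conjunct bounds the sum of the entries kept so far by twice the number
    of positions to the right of \<open>i - l\<close>. At \<open>i = 0\<close> it gives
    \<open>2 * n\<close>.\<close>
  have inv: "\<exists>D l. fold prune_step (rev [i + 1..<n + 1]) (C, 0) = (D, l) \<and>
      (\<forall>j\<le>i. D j = C j) \<and> (\<forall>j\<in>{1..n}. D j \<le> C j) \<and> l \<le> i \<and>
      (l = 0 \<or> (\<exists>j>i. j \<le> n \<and> C j \<noteq> 0 \<and> i - l = j - C j)) \<and>
      (\<Sum>j\<in>{i<..n}. D j) + 2 * i \<le> 2 * (n + l)" if "i \<le> n" for i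
    using that
  proof (induction i rule: inc_induct)
    case base
    then show ?case by auto
  next
    case (step i)
    then obtain D l where D: "fold prune_step (rev [Suc i + 1..<n + 1]) (C, 0) = (D, l)"
      "\<forall>j\<le>Suc i. D j = C j" "\<forall>j\<in>{1..n}. D j \<le> C j" "l \<le> Suc i"
      "l = 0 \<or> (\<exists>j>Suc i. j \<le> n \<and> C j \<noteq> 0 \<and> Suc i - l = j - C j)"
      "(\<Sum>j\<in>{Suc i<..n}. D j) + 2 * Suc i \<le> 2 * (n + l)"
      by auto
    have up: "[i + 1..<n + 1] = Suc i # [Suc i + 1..<n + 1]"
      using step.hyps by (simp add: upt_conv_Cons)
    have Ci: "C (Suc i) < Suc i" "D (Suc i) = C (Suc i)" using lt D(2) step.hyps by auto
    define D' where "D' = D(Suc i := if C (Suc i) \<le> l then 0 else C (Suc i))"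
    define l' where "l' = max l (C (Suc i)) - 1"
    have 1: "fold prune_step (rev [i + 1..<n + 1]) (C, 0) = (D', l')"
      using D(1) Ci unfolding up by (simp add: prune_step_eq D'_def l'_def)
    have ivl: "{i<..n} = insert (Suc i) {Suc i<..n}" using step.hyps by auto
    have "(\<Sum>j\<in>{Suc i<..n}. D' j) = (\<Sum>j\<in>{Suc i<..n}. D j)"
      by (rule sum.cong) (auto simp: D'_def)
    then have sum: "(\<Sum>j\<in>{i<..n}. D' j) =
        (if C (Suc i) \<le> l then 0 else C (Suc i)) + (\<Sum>j\<in>{Suc i<..n}. D j)"
      unfolding ivl by (simp add: D'_def)
    \<comment> \<open>Keeping the entry \<open>C (Suc i)\<close> adds it to the sum and raises the
      bound by \<open>2 * (C (Suc i) - l)\<close>. This suffices because \<open>l\<close>, the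
      overlap with later intervals, is at most half of the entry.\<close>
    have half: "2 * l \<le> C (Suc i)" if "l < C (Suc i)"
      using D(5)
    proof
      assume "\<exists>j>Suc i. j \<le> n \<and> C j \<noteq> 0 \<and> Suc i - l = j - C j"
      then obtain j where j: "Suc i < j" "j \<le> n" "C j \<noteq> 0" "Suc i - l = j - C j" by blast
      show ?thesis
      proof (cases "l = 0")
        case False
        then have "2 * (Suc i - (j - C j)) \<le> C (Suc i)"
          using ov[of "Suc i" j] j that Ci by auto
        then show ?thesis using j(4) D(4) by simp
      qed auto
    qed auto
    have 2: "(\<Sum>j\<in>{i<..n}. D' j) + 2 * i \<le> 2 * (n + l')"
      using half D(6) unfolding sum l'_def by auto
    have 3: "l' = 0 \<or> (\<exists>j>i. j \<le> n \<and> C j \<noteq> 0 \<and> i - l' = j - C j)"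
    proof (cases "C (Suc i) \<le> l")
      case True
      then show ?thesis using D(4,5) by (auto simp: l'_def intro: Suc_lessD)
    next
      case False
      then show ?thesis using step.hyps Ci by (intro disjI2 exI[of _ "Suc i"]) (auto simp: l'_def)
    qed
    have 4: "l' \<le> i" using D(4) Ci by (auto simp: l'_def)
    show ?case using 1 2 3 4 D(2,3) Ci
      by (intro exI[of _ D'] exI[of _ l']) (auto simp: D'_def)
  qed
  from inv[of 0] obtain D l where "fold prune_step (rev [1..<n + 1]) (C, 0) = (D, l)"
    "\<forall>j\<in>{1..n}. D j \<le> C j" "l = 0" "(\<Sum>j\<in>{0<..n}. D j) \<le> 2 * (n + l)"
    by auto
  moreover have "{0<..n} = {1..n}" by auto
  ultimately have D: "\<forall>j\<in>{1..n}. prune n C j \<le> C j" "(\<Sum>i\<in>{1..n}. prune n C i) \<le> 2 * n"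
    unfolding prune_def by (simp_all del: upt_Suc)
  show "prune n C i < i" if "i \<in> {1..n}" for i
    using D(1) lt that le_less_trans by blast
  show "(\<Sum>i\<in>{1..n}. prune n C i) \<le> 2 * n"
    by (rule D(2))
qed

section \<open>Steps 1 and 2 as programs\<close>

text \<open>\<open>K\<close> is the credit reserved for whatever follows, and the arbitrary
  continuation \<open>Q\<close> lets the rule apply in the middle of a program; the later rules for
  program parts have the same shape. One iteration costs at most 27 steps, the last test of the
  guard 5.\<close>

lemma run_max_to_min:
  assumes credits: "K + 30 * n + 10 \<le> m" and n: "vars s vN = n"
    and Q: "\<And>m' s'. K \<le> m' \<Longrightarrow> vars s' vN = n \<Longrightarrow> arrs s' Cov = max_to_min n (arrs s Cov) \<Longrightarrow> Q m' s'"
  shows "run max_to_min_com m s Q"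
proof -
  let ?step = "\<lambda>i C. if C i \<noteq> 0 \<and> C (C i) \<noteq> 0 then C(i := C (C i)) else (C :: nat \<Rightarrow> nat)"
  define I :: "nat \<Rightarrow> state \<Rightarrow> bool" where "I = (\<lambda>m' s'. \<exists>i\<ge>1. i \<le> n + 1 \<and> vars s' vI = i \<and> vars s' vN = n \<and>
      arrs s' Cov = fold ?step [1..<i] (arrs s Cov) \<and> K + 30 * (n + 1 - i) + 5 \<le> m')"
  show ?thesis
    unfolding max_to_min_com_def run_Seq
    apply (simp add: run_Assign set_var_def)
    apply (intro conjI)
    subgoal using credits by simp
    apply (rule run_While[where I = I])
    subgoal using credits n by (simp add: I_def)
    subgoal by (auto simp: I_def)
    subgoal for m' s'
      unfolding I_def
      apply (elim exE conjE)
      subgoal for i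
        by (auto simp add: run_simps fun_upd_def intro!: exI[of _ "Suc i"])
      done
    subgoal for m' s'
      unfolding I_def
      by (rule Q) (auto simp: max_to_min_def le_Suc_eq)
    done
qed

lemma run_prune:
  assumes credits: "K + 40 * n + 10 \<le> m" and n: "vars s vN = n"
    and Q: "\<And>m' s'. K \<le> m' \<Longrightarrow> vars s' vN = n \<Longrightarrow> arrs s' Cov = prune n (arrs s Cov) \<Longrightarrow> Q m' s'"
  shows "run prune_com m s Q"
proof -
  define I :: "nat \<Rightarrow> state \<Rightarrow> bool" where "I = (\<lambda>m' s'. \<exists>i\<le>n. vars s' vI = i \<and> vars s' vN = n \<and>
      fold prune_step (rev [i + 1..<n + 1]) (arrs s Cov, 0) = (arrs s' Cov, vars s' vL) \<and>
      K + 40 * i + 5 \<le> m')"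
  have upt: "rev [Suc i..<Suc n] = rev [Suc (Suc i)..<Suc n] @ [Suc i]" if "Suc i \<le> n" for i n
    using that by (simp add: upt_conv_Cons del: upt_Suc)
  show ?thesis
    unfolding prune_com_def run_Seq
    apply (simp add: run_Assign set_var_def)
    apply (intro conjI)
    subgoal using credits by simp
    subgoal using credits by simp
    apply (rule run_While[where I = I])
    subgoal using credits n by (simp add: I_def)
    subgoal by (auto simp: I_def)
    subgoal for m' s'
      unfolding I_def
      apply (elim exE conjE)
      subgoal for i
        apply (cases i)
         apply simp
        subgoal for i'
          apply (auto simp add: upt run_simps prune_step_eq max_def intro!: exI[of _ i'] simp del: upt_Suc)
          done
        done
      done
    subgoal for m' s'
      unfolding I_def
      by (rule Q) (auto simp: prune_def simp del: upt_Suc)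
    done
qed

section \<open>Building the graph\<close>

lemma run_init:
  assumes credits: "K + 30 * n + 10 \<le> m" and n: "vars s vN = n"
    and Q: "\<And>m' s'. K \<le> m' \<Longrightarrow> vars s' vN = n \<Longrightarrow> arrs s' Cov = arrs s Cov \<Longrightarrow>
      (\<forall>v\<in>{1..n}. arrs s' Head v = 0 \<and> arrs s' Txt v = 0) \<Longrightarrow> Q m' s'"
  shows "run init_com m s Q"
proof -
  define I :: "nat \<Rightarrow> state \<Rightarrow> bool" where "I = (\<lambda>m' s'. \<exists>i\<ge>1. i \<le> n + 1 \<and> vars s' vI = i \<and>
      vars s' vN = n \<and> arrs s' Cov = arrs s Cov \<and>
      (\<forall>v\<in>{1..<i}. arrs s' Head v = 0 \<and> arrs s' Txt v = 0) \<and> K + 30 * (n + 1 - i) + 5 \<le> m')"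
  show ?thesis
    unfolding init_com_def run_Seq
    apply (simp add: run_Assign set_var_def del: One_nat_def)
    apply (intro conjI)
    subgoal using credits by simp
    apply (rule run_While[where I = I])
    subgoal using credits n by (simp add: I_def)
    subgoal by (auto simp: I_def)
    subgoal for m' s'
      unfolding I_def
      apply (elim exE conjE)
      subgoal for i
        by (auto simp add: run_simps intro!: exI[of _ "Suc i"])
      done
    subgoal for m' s'
      unfolding I_def
      by (rule Q) (auto simp: le_Suc_eq)
    done
qed

text \<open>The bound \<open>E\<close> on the cells keeps a list unaffected by the allocation of cell \<open>Suc E\<close>.\<close>

fun chain :: "(nat \<Rightarrow> nat) \<Rightarrow> (nat \<Rightarrow> nat) \<Rightarrow> nat \<Rightarrow> nat \<Rightarrow> nat list \<Rightarrow> bool" where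
  "chain nxt tgt E e [] \<longleftrightarrow> e = 0"
| "chain nxt tgt E e (w # ws) \<longleftrightarrow> e \<noteq> 0 \<and> e \<le> E \<and> tgt e = w \<and> chain nxt tgt E (nxt e) ws"

lemma chain_alloc:
  "chain nxt tgt E e ws \<Longrightarrow> chain (nxt(Suc E := a)) (tgt(Suc E := b)) (Suc E) e ws"
  by (induction ws arbitrary: e) auto

definition adjacency :: "nat \<Rightarrow> state \<Rightarrow> nat \<Rightarrow> (nat \<Rightarrow> nat list) \<Rightarrow> bool" where
  "adjacency n s E adj \<longleftrightarrow>
    (\<forall>v\<in>{1..n}. chain (arrs s Next) (arrs s Target) E (arrs s Head v) (adj v))"

text \<open>The relation forgets parallel edges, but the total length counts every cell; the search
  is charged for cells, not for distinct edges.\<close>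

definition stores_graph :: "nat \<Rightarrow> state \<Rightarrow> nat \<Rightarrow> (nat \<times> nat) set \<Rightarrow> bool" where
  "stores_graph n s E R \<longleftrightarrow> (\<exists>adj. adjacency n s E adj \<and>
    (\<forall>v\<in>{1..n}. set (adj v) = R `` {v}) \<and> (\<Sum>v\<in>{1..n}. length (adj v)) = E)"

lemma stores_graph_cong:
  assumes "stores_graph n s E R" "\<And>A. A \<in> {Head, Next, Target} \<Longrightarrow> arrs s' A = arrs s A"
  shows "stores_graph n s' E R"
  using assms unfolding stores_graph_def adjacency_def by simp

text \<open>\<open>u\<close> and \<open>v\<close> have to differ from \<open>vE\<close>, which is
  incremented before they are read.\<close>

lemma run_add_arc:
  assumes credits: "K + 15 \<le> m"
    and st: "stores_graph n s (vars s vE) R" "u \<noteq> vE" "v \<noteq> vE" "vars s u \<in> {1..n}"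
    and Q: "\<And>m' s'. K \<le> m' \<Longrightarrow> vars s' = (vars s)(vE := Suc (vars s vE)) \<Longrightarrow>
      arrs s' Cov = arrs s Cov \<Longrightarrow> arrs s' Txt = arrs s Txt \<Longrightarrow>
      stores_graph n s' (vars s' vE) (insert (vars s u, vars s v) R) \<Longrightarrow> Q m' s'"
  shows "run (add_arc_com u v) m s Q"
proof -
  obtain adj where adj: "adjacency n s (vars s vE) adj"
    "\<forall>v\<in>{1..n}. set (adj v) = R `` {v}" "(\<Sum>v\<in>{1..n}. length (adj v)) = vars s vE"
    using st(1) unfolding stores_graph_def by blast
  define x where "x = vars s u"
  define adj' where "adj' = adj(x := vars s v # adj x)"
  have x: "x \<in> {1..n}" using st x_def by simp
  have "(\<Sum>v\<in>{1..n}. length (adj' v)) = Suc (\<Sum>v\<in>{1..n}. length (adj v))"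
    using x by (simp add: adj'_def sum.remove[of _ x])
  moreover have "\<forall>w\<in>{1..n}. set (adj' w) = insert (vars s u, vars s v) R `` {w}"
    using adj(2) x unfolding adj'_def x_def by auto
  moreover have "adjacency n s' (Suc (vars s vE)) adj'"
    if "arrs s' Next = (arrs s Next)(Suc (vars s vE) := arrs s Head x)"
      "arrs s' Target = (arrs s Target)(Suc (vars s vE) := vars s v)"
      "arrs s' Head = (arrs s Head)(x := Suc (vars s vE))" for s' :: state
    using adj(1) x unfolding adjacency_def that adj'_def by (auto intro: chain_alloc)
  ultimately have post: "stores_graph n s' (Suc (vars s vE)) (insert (vars s u, vars s v) R)"
    if "arrs s' Next = (arrs s Next)(Suc (vars s vE) := arrs s Head x)"
      "arrs s' Target = (arrs s Target)(Suc (vars s vE) := vars s v)"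
      "arrs s' Head = (arrs s Head)(x := Suc (vars s vE))" for s' :: state
    using that adj(3) unfolding stores_graph_def by (metis)
  show ?thesis
    unfolding add_arc_com_def
    using st credits
    apply (simp add: run_simps del: fun_upd_apply)
    apply (simp add: run_simps)
    apply (intro conjI)
       apply simp_all[3]
    apply (rule Q)
        apply simp_all
    apply (rule post)
      apply (simp_all add: x_def)
    done
qed

text \<open>Separating the count \<open>k\<close> from the offset \<open>c\<close> lets an invariant
  describe the inner loop while it is running.\<close>

definition edges_at :: "nat \<Rightarrow> nat \<Rightarrow> nat \<Rightarrow> (nat \<times> nat) set" where
  "edges_at i c k = {(u, v). \<exists>j\<in>{1..k}. {u, v} = {j, i - c + j}}"

lemma edge_rel_Suc:
  "edge_rel (Suc i) C = edge_rel i C \<union> edges_at (Suc i) (C (Suc i)) (C (Suc i))"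
proof -
  have "{1..Suc i} = insert (Suc i) {1..i}" by auto
  then show ?thesis unfolding edge_rel_def edges_at_def by (simp only:) blast
qed

lemma edge_rel_sym: "sym (edge_rel n C)"
  unfolding edge_rel_def sym_def by (auto simp: insert_commute)

text \<open>\<open>C i < i\<close> keeps the truncated subtraction exact and both ends in
  \<open>{1..n}\<close>, the range where adjacency lists are maintained.\<close>

lemma edge_rel_subset:
  assumes "\<And>i. i \<in> {1..n} \<Longrightarrow> C i < i"
  shows "edge_rel n C \<subseteq> {1..n} \<times> {1..n}"
  using assms unfolding edge_rel_def by (fastforce simp: doubleton_eq_iff)

lemma run_add_edges:
  assumes credits: "K + 60 * C i + 10 \<le> m"
    and st: "stores_graph n s (vars s vE) R0" "vars s vI = i" "vars s vJ = 1"
      "arrs s Cov = C" "1 \<le> i" "i \<le> n" "C i < i"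
    and Q: "\<And>m' s'. K \<le> m' \<Longrightarrow> vars s' vI = i \<Longrightarrow> vars s' vN = vars s vN \<Longrightarrow>
      vars s' vE = vars s vE + 2 * C i \<Longrightarrow>
      arrs s' Cov = C \<Longrightarrow> arrs s' Txt = arrs s Txt \<Longrightarrow>
      stores_graph n s' (vars s' vE) (R0 \<union> edges_at i (C i) (C i)) \<Longrightarrow> Q m' s'"
  shows "run (WHILE V vJ \<preceq> Cov\<langle>V vI\<rangle> DO (
        vK ::= (V vI \<ominus> Cov\<langle>V vI\<rangle>) \<oplus> V vJ;;
        add_arc_com vJ vK;;
        add_arc_com vK vJ;;
        vJ ::= V vJ \<oplus> N 1)) m s Q"
proof -
  define I :: "nat \<Rightarrow> state \<Rightarrow> bool" where "I = (\<lambda>m' s'. \<exists>j\<ge>1. j \<le> Suc (C i) \<and>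
      vars s' vJ = j \<and> vars s' vI = i \<and>
      vars s' vN = vars s vN \<and> vars s' vE = vars s vE + 2 * (j - 1) \<and>
      arrs s' Cov = C \<and> arrs s' Txt = arrs s Txt \<and> stores_graph n s' (vars s' vE) (R0 \<union> edges_at i (C i) (j - 1)) \<and>
      K + 60 * (Suc (C i) - j) + 6 \<le> m')"
  have R_Suc: "insert (i - C i + j, j) (insert (j, i - C i + j) (R0 \<union> edges_at i (C i) (j - Suc 0))) =
      R0 \<union> edges_at i (C i) j" if "Suc 0 \<le> j" for j
  proof -
    have "{1..j} = insert j {1..j - 1}" using that by auto
    then show ?thesis unfolding edges_at_def by (auto simp: doubleton_eq_iff)
  qed
  have R1: "R0 \<union> edges_at i (C i) 0 = R0" unfolding edges_at_def by auto
  show ?thesis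
    apply (rule run_While[where I = I])
    subgoal using credits st R1 by (simp add: I_def)
    subgoal by (auto simp: I_def)
    subgoal for m' s'
      unfolding I_def
      apply (elim exE conjE)
      subgoal for j
        apply (simp add: run_Seq run_Assign set_var_def del: One_nat_def)
        apply (intro conjI)
         apply linarith
        apply (rule run_add_arc[where K = "K + 60 * (C i - j) + 30" and n = n
              and R = "R0 \<union> edges_at i (C i) (j - 1)"])
        subgoal by linarith
        subgoal by (simp, erule stores_graph_cong, simp)
        subgoal by simp
        subgoal by simp
        subgoal using st by simp
        subgoal for m1 s1
          apply (rule run_add_arc[where K = "K + 60 * (C i - j) + 15" and n = n
                and R = "insert (j, i - C i + j) (R0 \<union> edges_at i (C i) (j - 1))"])
          subgoal by linarith
          subgoal by simp
          subgoal by simp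
          subgoal by simp
          subgoal using st by (simp, linarith)
          subgoal for m2 s2
            apply (simp add: run_Assign set_var_def)
            apply (intro conjI)
            subgoal by linarith
            subgoal using R_Suc[of j] by (simp, elim stores_graph_cong, simp)
            subgoal by linarith
            done
          done
        done
      done
    subgoal for m' s'
      unfolding I_def
      by (rule Q) (auto simp: le_Suc_eq)
    done
qed

lemma run_build_graph:
  assumes credits: "K + 60 * (\<Sum>i\<in>{1..n}. C i) + 30 * n + 10 \<le> m" and n: "vars s vN = n"
    and st: "\<And>v. v \<in> {1..n} \<Longrightarrow> arrs s Head v = 0" "arrs s Cov = C"
      "\<And>i. i \<in> {1..n} \<Longrightarrow> C i < i"
    and Q: "\<And>m' s'. K \<le> m' \<Longrightarrow> vars s' vN = n \<Longrightarrow> arrs s' Txt = arrs s Txt \<Longrightarrow>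
      stores_graph n s' (2 * (\<Sum>i\<in>{1..n}. C i)) (edge_rel n C) \<Longrightarrow> Q m' s'"
  shows "run build_graph_com m s Q"
proof -
  define I :: "nat \<Rightarrow> state \<Rightarrow> bool" where "I = (\<lambda>m' s'. \<exists>i\<le>n. vars s' vI = Suc i \<and>
      vars s' vN = n \<and> vars s' vE = 2 * (\<Sum>i\<in>{1..i}. C i) \<and>
      arrs s' Cov = C \<and> arrs s' Txt = arrs s Txt \<and> stores_graph n s' (vars s' vE) (edge_rel i C) \<and>
      K + 60 * (\<Sum>i\<in>{i<..n}. C i) + 30 * (n - i) + 6 \<le> m')"
  have empty: "stores_graph n s' 0 (edge_rel 0 C)" if "arrs s' Head = arrs s Head" for s' :: state
    using st that unfolding stores_graph_def adjacency_def edge_rel_def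
    by (intro exI[of _ "\<lambda>_. []"]) auto
  have tail: "(\<Sum>i\<in>{i<..n}. C i) = C (Suc i) + (\<Sum>i\<in>{Suc i<..n}. C i)" if "i < n" for i
  proof -
    have "{i<..n} = insert (Suc i) {Suc i<..n}" using that by auto
    then show ?thesis by simp
  qed
  have diff: "n - i = Suc (n - Suc i)" if "i < n" for i
    using that by simp
  have all: "{0<..n} = {1..n}" by auto
  show ?thesis
    unfolding build_graph_com_def run_Seq
    apply (simp add: run_Assign set_var_def del: One_nat_def)
    apply (intro conjI)
    subgoal using credits by simp
    subgoal using credits by simp
    apply (rule run_While[where I = I])
    subgoal using credits n st empty all by (simp add: I_def)
    subgoal by (auto simp: I_def)
    subgoal for m' s'
      unfolding I_def
      apply (elim exE conjE)
      subgoal for i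
        apply (simp add: run_Seq run_Assign set_var_def del: One_nat_def)
        apply (intro conjI)
         apply linarith
        apply (rule run_add_edges[where K = "K + 60 * (\<Sum>i\<in>{Suc i<..n}. C i) + 30 * (n - Suc i) + 10"
              and n = n and ?R0.0 = "edge_rel i C" and i = "Suc i" and C = C])
        subgoal using tail[of i] diff[of i] by (simp add: distrib_left)
        subgoal by (simp, erule stores_graph_cong, simp)
        subgoal by simp
        subgoal by simp
        subgoal by simp
        subgoal by simp
        subgoal by simp
        subgoal using st(3) by simp
        subgoal for m1 s1
          apply (simp add: run_Assign set_var_def)
          apply (intro conjI)
          subgoal unfolding edge_rel_Suc by (erule stores_graph_cong, simp)
          subgoal by linarith
          done
        done
      done
    subgoal for m' s'
      unfolding I_def
      apply (elim exE conjE)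
      subgoal for i
        by (cases "i = n") (auto intro: Q)
      done
    done
qed

section \<open>Depth-first search\<close>

text \<open>\<open>pending v\<close> is the part of the adjacency list of \<open>v\<close> that the search has not scanned yet, and
  \<open>S\<close> is the set of vertices on the stack.\<close>

definition search_state ::
  "nat \<Rightarrow> nat \<Rightarrow> (nat \<times> nat) set \<Rightarrow> nat set \<Rightarrow> (nat \<Rightarrow> nat list) \<Rightarrow> state \<Rightarrow> bool" where
  "search_state n E R S pending s \<longleftrightarrow> adjacency n s E pending \<and>
    (\<forall>v\<in>{1..n}. set (pending v) \<subseteq> R `` {v} \<and> R `` {v} \<subseteq> set (pending v) \<union> {w. arrs s Txt w \<noteq> 0} \<and>
      (arrs s Txt v \<noteq> 0 \<longrightarrow> v \<in> S \<or> pending v = []))"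

text \<open>The work left for all remaining searches, not only the current one. An unassigned vertex
  counts twice: one unit goes with it onto the stack and pays for the pop, the other covers the
  assignment, which at the root of a search is not paid for by any scanned cell.\<close>

definition workload :: "nat \<Rightarrow> (nat \<Rightarrow> nat list) \<Rightarrow> state \<Rightarrow> nat" where
  "workload n pending s =
    (\<Sum>v\<in>{1..n}. length (pending v)) + 2 * card {v \<in> {1..n}. arrs s Txt v = 0}"

lemma workload_assign:
  assumes "arrs s Txt w = 0" "w \<in> {1..n}" "c \<noteq> 0" "arrs s' Txt = (arrs s Txt)(w := c)"
  shows "workload n p s = workload n p s' + 2"
proof -
  have "{v \<in> {1..n}. arrs s' Txt v = 0} = {v \<in> {1..n}. arrs s Txt v = 0} - {w}"
    using assms by auto
  moreover have "w \<in> {v \<in> {1..n}. arrs s Txt v = 0}" using assms by auto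
  ultimately have "card {v \<in> {1..n}. arrs s Txt v = 0} = Suc (card {v \<in> {1..n}. arrs s' Txt v = 0})"
    using card.remove[of "{v \<in> {1..n}. arrs s Txt v = 0}" w] by simp
  then show ?thesis unfolding workload_def by simp
qed

lemma workload_scan:
  assumes "p v = w # ws" "v \<in> {1..n}"
  shows "workload n p s = workload n (p(v := ws)) s + 1"
  using assms unfolding workload_def by (simp add: sum.remove[of _ v])

lemma workload_cong: "arrs s' Txt = arrs s Txt \<Longrightarrow> workload n p s' = workload n p s"
  unfolding workload_def by simp

lemma search_state_cong:
  assumes "search_state n E R S p s" "\<And>A. A \<in> {Head, Next, Target, Txt} \<Longrightarrow> arrs s' A = arrs s A"
  shows "search_state n E R S p s'"
  using assms unfolding search_state_def adjacency_def by simp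

lemma search_state_pop:
  assumes "search_state n E R S p s" "arrs s Head v = 0" "v \<in> {1..n}" "S \<subseteq> insert v S'"
    "\<And>A. A \<in> {Head, Next, Target, Txt} \<Longrightarrow> arrs s' A = arrs s A"
  shows "search_state n E R S' p s'"
proof -
  have "chain (arrs s Next) (arrs s Target) E (arrs s Head v) (p v)"
    using assms(1,3) unfolding search_state_def adjacency_def by blast
  then have "p v = []" using assms(2) by (cases "p v") auto
  then show ?thesis using assms unfolding search_state_def adjacency_def by auto
qed

text \<open>Dropping \<open>w\<close> from the pending list is safe, since \<open>w\<close> has a
  letter afterwards in either case: it had one already, or it receives one and joins the
  stack.\<close>

lemma search_state_scan:
  assumes st: "search_state n E R S p s" "p v = w # ws" "v \<in> {1..n}" "S \<subseteq> S'"
    and s': "arrs s' Head = (arrs s Head)(v := arrs s Next (arrs s Head v))"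
      "arrs s' Next = arrs s Next" "arrs s' Target = arrs s Target"
      "arrs s' Txt = arrs s Txt \<and> arrs s Txt w \<noteq> 0 \<or>
       (\<exists>c. c \<noteq> 0 \<and> arrs s' Txt = (arrs s Txt)(w := c)) \<and> w \<in> S'"
      "v \<in> S'"
  shows "search_state n E R S' (p(v := ws)) s'"
proof -
  have w: "arrs s' Txt w \<noteq> 0" and mono: "\<And>u. arrs s Txt u \<noteq> 0 \<Longrightarrow> arrs s' Txt u \<noteq> 0"
    and new: "\<And>u. arrs s' Txt u \<noteq> 0 \<Longrightarrow> arrs s Txt u \<noteq> 0 \<or> u \<in> S'"
    using s'(4) by (auto split: if_splits)
  have adj: "adjacency n s' E (p(v := ws))"
    using st(1-3) s'(1-3) unfolding search_state_def adjacency_def by (auto dest!: bspec[of _ _ v])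
  have *: "set (p u) \<subseteq> R `` {u}" "R `` {u} \<subseteq> set (p u) \<union> {w. arrs s Txt w \<noteq> 0}"
    "arrs s Txt u \<noteq> 0 \<Longrightarrow> u \<in> S \<or> p u = []" if "u \<in> {1..n}" for u
    using st(1) that unfolding search_state_def by auto
  have "set ((p(v := ws)) u) \<subseteq> R `` {u} \<and> R `` {u} \<subseteq> set ((p(v := ws)) u) \<union> {w. arrs s' Txt w \<noteq> 0} \<and>
      (arrs s' Txt u \<noteq> 0 \<longrightarrow> u \<in> S' \<or> (p(v := ws)) u = [])" if u: "u \<in> {1..n}" for u
  proof (cases "u = v")
    case True
    then show ?thesis using *[OF u] st(2) w mono s'(5) by auto
  next
    case False
    have "arrs s' Txt u \<noteq> 0 \<longrightarrow> u \<in> S' \<or> p u = []" using *(3)[OF u] new st(4) by blast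
    moreover have "R `` {u} \<subseteq> set (p u) \<union> {w. arrs s' Txt w \<noteq> 0}" using *(2)[OF u] mono by blast
    ultimately show ?thesis using *(1)[OF u] False by simp
  qed
  with adj show ?thesis unfolding search_state_def by blast
qed

lemma search_state_start:
  assumes "search_state n E R {} p s" "c \<noteq> 0" "arrs s' Txt = (arrs s Txt)(i := c)"
    "\<And>A. A \<in> {Head, Next, Target} \<Longrightarrow> arrs s' A = arrs s A"
  shows "search_state n E R {i} p s'"
proof -
  have mono: "{w. arrs s Txt w \<noteq> 0} \<subseteq> {w. arrs s' Txt w \<noteq> 0}" using assms(2,3) by auto
  have "set (p v) \<subseteq> R `` {v} \<and> R `` {v} \<subseteq> set (p v) \<union> {w. arrs s' Txt w \<noteq> 0} \<and>
      (arrs s' Txt v \<noteq> 0 \<longrightarrow> v \<in> {i} \<or> p v = [])" if v: "v \<in> {1..n}" for v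
  proof (intro conjI impI)
    have *: "set (p v) \<subseteq> R `` {v}" "R `` {v} \<subseteq> set (p v) \<union> {w. arrs s Txt w \<noteq> 0}"
      "arrs s Txt v \<noteq> 0 \<longrightarrow> p v = []"
      using assms(1) v unfolding search_state_def by blast+
    show "set (p v) \<subseteq> R `` {v}" by (rule *(1))
    show "R `` {v} \<subseteq> set (p v) \<union> {w. arrs s' Txt w \<noteq> 0}" using *(2) mono by blast
    show "v \<in> {i} \<or> p v = []" if "arrs s' Txt v \<noteq> 0"
      using *(3) that assms(3) by (cases "v = i") simp_all
  qed
  then show ?thesis using assms(1,4) unfolding search_state_def adjacency_def by simp
qed

text \<open>With an empty stack every assigned vertex has exhausted its list, so all its neighbours
  are assigned. This serves both for components finished earlier and for the one just
  searched.\<close>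

lemma search_state_closed:
  assumes "search_state n E R {} p s" "(u, v) \<in> R\<^sup>*" "R \<subseteq> {1..n} \<times> {1..n}" "arrs s Txt u \<noteq> 0"
  shows "arrs s Txt v \<noteq> 0"
  using assms(2)
proof induction
  case (step v w)
  then have "v \<in> {1..n}" using assms by auto
  with step.IH assms(1) have "p v = []" "R `` {v} \<subseteq> set (p v) \<union> {w. arrs s Txt w \<noteq> 0}"
    unfolding search_state_def by blast+
  with step.hyps(2) show ?case by auto
qed (use assms in auto)

lemma run_dfs:
  assumes credits: "K + 40 * workload n p s \<le> m"
    and R: "R \<subseteq> {1..n} \<times> {1..n}" "sym R"
    and st: "search_state n E R {} p s" "vars s vI \<in> {1..n}" "arrs s Txt (vars s vI) = 0"
      "vars s vC \<noteq> 0"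
    and Q: "\<And>m' s' p'. K + 40 * workload n p' s' \<le> m' \<Longrightarrow> search_state n E R {} p' s' \<Longrightarrow>
      vars s' vI = vars s vI \<Longrightarrow> vars s' vN = vars s vN \<Longrightarrow> arrs s' Bord = arrs s Bord \<Longrightarrow>
      (\<forall>q\<in>{1..n}. arrs s' Txt q =
        (if (vars s vI, q) \<in> R\<^sup>* then vars s vC else arrs s Txt q)) \<Longrightarrow> Q m' s'"
  shows "run dfs_com m s Q"
proof -
  define i where "i = vars s vI"
  define c where "c = vars s vC"
  \<comment> \<open>Each stack entry carries the credit for its pop; the additional 6 pays for the
    final test of the guard.\<close>
  define I :: "nat \<Rightarrow> state \<Rightarrow> bool" where "I = (\<lambda>m' s'. \<exists>p'.
      (\<forall>k\<in>{1..vars s' vTop}. arrs s' Stack k \<in> {1..n} \<and> (i, arrs s' Stack k) \<in> R\<^sup>*) \<and>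
      search_state n E R (arrs s' Stack ` {1..vars s' vTop}) p' s' \<and>
      (\<forall>q\<in>{1..n}. arrs s' Txt q = arrs s Txt q \<or> arrs s' Txt q = c \<and> (i, q) \<in> R\<^sup>*) \<and>
      arrs s' Txt i = c \<and> vars s' vI = i \<and> vars s' vC = c \<and> vars s' vN = vars s vN \<and>
      arrs s' Bord = arrs s Bord \<and> K + 40 * (workload n p' s' + vars s' vTop) + 6 \<le> m')"
  have I_intro: "I m' s'"
    if "vars s' vTop = top"
      "\<And>k. k \<in> {1..top} \<Longrightarrow> arrs s' Stack k \<in> {1..n} \<and> (i, arrs s' Stack k) \<in> R\<^sup>*"
      "search_state n E R (arrs s' Stack ` {1..top}) p' s'"
      "\<And>q. q \<in> {1..n} \<Longrightarrow> arrs s' Txt q = arrs s Txt q \<or> arrs s' Txt q = c \<and> (i, q) \<in> R\<^sup>*"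
      "arrs s' Txt i = c" "vars s' vI = i" "vars s' vC = c" "vars s' vN = vars s vN"
      "arrs s' Bord = arrs s Bord" "K + 40 * (workload n p' s' + top) + 6 \<le> m'"
    for m' s' p' top
    using that(2-) unfolding I_def that(1) by blast
  have step: "run (
      vV ::= Stack\<langle>V vTop\<rangle>;;
      vE ::= Head\<langle>V vV\<rangle>;;
      IF V vE \<doteq> N 0 THEN vTop ::= V vTop \<ominus> N 1
      ELSE (
        Head\<langle>V vV\<rangle> ::= Next\<langle>V vE\<rangle>;;
        vU ::= Target\<langle>V vE\<rangle>;;
        IF Txt\<langle>V vU\<rangle> \<doteq> N 0 THEN (
          Txt\<langle>V vU\<rangle> ::= V vC;;
          vTop ::= V vTop \<oplus> N 1;;
          Stack\<langle>V vTop\<rangle> ::= V vU)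
        ELSE Skip)) (m' - 5) s' I"
    if I: "I m' s'" and top: "vars s' vTop \<ge> 1" for m' s'
  proof -
    from I obtain p' where I: "\<forall>k\<in>{1..vars s' vTop}. arrs s' Stack k \<in> {1..n} \<and> (i, arrs s' Stack k) \<in> R\<^sup>*"
      "search_state n E R (arrs s' Stack ` {1..vars s' vTop}) p' s'"
      "\<forall>q\<in>{1..n}. arrs s' Txt q = arrs s Txt q \<or> arrs s' Txt q = c \<and> (i, q) \<in> R\<^sup>*"
      "arrs s' Txt i = c" "vars s' vI = i" "vars s' vC = c" "vars s' vN = vars s vN"
      "arrs s' Bord = arrs s Bord" "K + 40 * (workload n p' s' + vars s' vTop) + 6 \<le> m'"
      unfolding I_def by (elim exE conjE) (rule that)
    obtain top where t: "vars s' vTop = Suc top" using top by (cases "vars s' vTop") auto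
    define v where "v = arrs s' Stack (Suc top)"
    have v: "v \<in> {1..n}" "(i, v) \<in> R\<^sup>*" using I(1) t by (auto simp: v_def)
    have stack: "arrs s' Stack ` {1..Suc top} = insert v (arrs s' Stack ` {1..top})"
      by (auto simp: v_def atLeastAtMostSuc_conv)
    have chain: "chain (arrs s' Next) (arrs s' Target) E (arrs s' Head v) (p' v)"
      using I(2) v unfolding search_state_def adjacency_def by blast
    show ?thesis
    proof (cases "p' v")
      case Nil
      then have h: "arrs s' Head v = 0" using chain by simp
      have claim: "I k s''" if "vars s'' = (vars s')(vV := v, vE := 0, vTop := top)" "arrs s'' = arrs s'"
        "K + 40 * (workload n p' s' + top) + 6 \<le> k" for k s''
      proof (rule I_intro[where p' = p' and top = top])
        show "search_state n E R (arrs s'' Stack ` {1..top}) p' s''"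
          by (rule search_state_pop[OF I(2) h v(1)]) (use stack that t in auto)
        show "K + 40 * (workload n p' s'' + top) + 6 \<le> k"
          using that workload_cong[of s'' s'] by simp
      qed (use that I(1,3-8) t in auto)
      show ?thesis using h I(9) t
        by (simp add: run_simps v_def[symmetric], intro conjI claim) (linarith | simp)+
    next
      case (Cons w ws)
      then have e: "arrs s' Head v \<noteq> 0" "arrs s' Target (arrs s' Head v) = w" using chain by auto
      have w: "(v, w) \<in> R" using I(2) v Cons unfolding search_state_def by force
      then have w': "w \<in> {1..n}" "(i, w) \<in> R\<^sup>*" using R v(2) by auto
      have load: "workload n p' s' = workload n (p'(v := ws)) s' + 1"
        using workload_scan[of p' v w ws n s', OF Cons v(1)] .
      show ?thesis
      proof (cases "arrs s' Txt w = 0")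
        case False
        have claim: "I k s''" if "vars s'' = (vars s')(vV := v, vE := arrs s' Head v, vU := w)"
          "arrs s'' = (arrs s')(Head := (arrs s' Head)(v := arrs s' Next (arrs s' Head v)))"
          "K + 40 * (workload n (p'(v := ws)) s' + Suc top) + 6 \<le> k" for k s''
        proof (rule I_intro[where p' = "p'(v := ws)" and top = "Suc top"])
          show "search_state n E R (arrs s'' Stack ` {1..Suc top}) (p'(v := ws)) s''"
            by (rule search_state_scan[OF I(2) Cons v(1)]) (use stack that t False in auto)
          show "K + 40 * (workload n (p'(v := ws)) s'' + Suc top) + 6 \<le> k"
            using that workload_cong[of s'' s'] by simp
        qed (use that I(1,3-8) t in auto)
        show ?thesis using False e load I(9) t
          by (simp add: run_simps v_def[symmetric], intro conjI claim) (linarith | simp)+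
      next
        case True
        \<comment> \<open>The workload falls by 3, one for the scanned cell and two for
          \<open>w\<close>, while the stack grows by one entry; two units remain to pay for the
          iteration.\<close>
        have claim: "I k s''" if
          "vars s'' = (vars s')(vV := v, vE := arrs s' Head v, vU := w, vTop := Suc (Suc top))"
          "arrs s'' = (arrs s')(Head := (arrs s' Head)(v := arrs s' Next (arrs s' Head v)),
            Txt := (arrs s' Txt)(w := c), Stack := (arrs s' Stack)(Suc (Suc top) := w))"
          "K + 40 * (workload n p' s' + top) + 6 \<le> k + 40" for k s''
        proof (rule I_intro[where p' = "p'(v := ws)" and top = "Suc (Suc top)"])
          have "arrs s'' Stack ` {1..Suc (Suc top)} = insert w (insert v (arrs s' Stack ` {1..top}))"
            using that(2) stack[symmetric] by (auto simp: atLeastAtMostSuc_conv)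
          then show "search_state n E R (arrs s'' Stack ` {1..Suc (Suc top)}) (p'(v := ws)) s''"
            using st(4) c_def
            by (intro search_state_scan[OF I(2) Cons v(1)]) (use stack that t in auto)
          show "K + 40 * (workload n (p'(v := ws)) s'' + Suc (Suc top)) + 6 \<le> k"
            using that load workload_assign[OF True w'(1), of c s'' "p'(v := ws)"] st(4) c_def by simp
          show "arrs s'' Stack k \<in> {1..n} \<and> (i, arrs s'' Stack k) \<in> R\<^sup>*"
            if "k \<in> {1..Suc (Suc top)}" for k
            using that w' I(1) t \<open>arrs s'' = _\<close> by (cases "k = Suc (Suc top)") auto
        qed (use that I(1,3-8) t w' in auto)
        have "K + 40 * (workload n p' s' + top) + 46 \<le> m'" using I(9) t by simp
        note bound = this
        show ?thesis
          apply (simp add: run_simps v_def[symmetric] True e I(6) t del: One_nat_def)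
          apply (intro conjI claim)
          using bound apply linarith
          using bound apply linarith
          using bound apply linarith
          using bound apply linarith
          using bound apply linarith
          using bound apply linarith
          using bound apply linarith
          using bound apply linarith
          using bound apply linarith
          apply simp
          apply simp
          using bound apply linarith
          done
      qed
    qed
  qed
  have init: "I k s'" if "vars s' = (vars s)(vTop := 1)"
    "arrs s' = (arrs s)(Txt := (arrs s Txt)(i := c), Stack := (arrs s Stack)(1 := i))"
    "K + 40 * workload n p s \<le> k + 20" for k s'
  proof (rule I_intro[where p' = p and top = 1])
    show "search_state n E R (arrs s' Stack ` {1..1}) p s'"
      by (simp, rule search_state_start[OF st(1,4)]) (use that in \<open>auto simp: c_def\<close>)
    show "K + 40 * (workload n p s' + 1) + 6 \<le> k"
      using that workload_assign[OF st(3,2,4), of s' p] by (simp add: i_def c_def)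
  qed (use that st in \<open>auto simp: i_def c_def\<close>)
  have exit: "Q k s'" if I: "I m' s'" and top: "vars s' vTop = 0" and k: "m' \<le> k + 5" for m' k s'
  proof -
    obtain p' where p': "search_state n E R {} p' s'"
      "\<forall>q\<in>{1..n}. arrs s' Txt q = arrs s Txt q \<or> arrs s' Txt q = c \<and> (i, q) \<in> R\<^sup>*"
      "arrs s' Txt i = c" "vars s' vI = i" "vars s' vN = vars s vN" "arrs s' Bord = arrs s Bord"
      "K + 40 * workload n p' s' + 6 \<le> m'"
      using I top unfolding I_def by auto
    have "arrs s' Txt q = (if (i, q) \<in> R\<^sup>* then c else arrs s Txt q)" if q: "q \<in> {1..n}" for q
    proof (cases "(i, q) \<in> R\<^sup>*")
      case True
      \<comment> \<open>A letter at \<open>q\<close> before the search would, by closure, already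
        have reached \<open>i\<close>, which was unassigned.\<close>
      then have "(q, i) \<in> R\<^sup>*" using R(2) by (meson symD sym_rtrancl)
      then have "arrs s Txt q = 0"
        using search_state_closed[OF st(1) _ R(1), of q i] st(3) by (fastforce simp: i_def)
      moreover have "arrs s' Txt q \<noteq> 0"
        using search_state_closed[OF p'(1) True R(1)] p'(3) st(4) by (simp add: c_def)
      ultimately show ?thesis using p'(2)[rule_format, OF q] True by auto
    qed (use p'(2) q in auto)
    then show ?thesis
      using p' k by (intro Q[of p']) (simp_all add: i_def c_def)
  qed
  \<comment> \<open>The start is itself unassigned, so it brings the two units of workload from
    which the initial commands are paid.\<close>
  have bound: "K + 40 * workload n p s \<le> m" "workload n p s \<ge> 2"
    using credits workload_assign[OF st(3,2,4), of "set_arr Txt (vars s vI) (vars s vC) s" p]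
    by (auto simp: set_arr_def)
  show ?thesis
    unfolding dfs_com_def
    apply (simp add: run_simps del: One_nat_def)
    apply (intro conjI)
    subgoal using bound by linarith
    subgoal using bound by linarith
    subgoal using bound by linarith
    subgoal
      apply (rule run_While[where I = I])
      subgoal
        apply (rule init)
        subgoal by (simp add: i_def c_def)
        subgoal by (simp add: i_def c_def)
        subgoal using bound by linarith
        done
      subgoal by (auto simp: I_def)
      subgoal for m' s'
        using step[of m' s'] by (simp del: One_nat_def)
      subgoal for m' s'
        by (rule exit[of m' s']) simp_all
      done
    done
qed

section \<open>Borders and the failure function\<close>

definition border :: "(nat \<Rightarrow> 'a) \<Rightarrow> nat \<Rightarrow> nat \<Rightarrow> bool" where
  "border g k b \<longleftrightarrow> b < k \<and> (\<forall>j\<in>{1..b}. g j = g (k - b + j))"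

definition longest :: "(nat \<Rightarrow> 'a) \<Rightarrow> nat \<Rightarrow> nat \<Rightarrow> bool" where
  "longest g k b \<longleftrightarrow> border g k b \<and> (\<forall>b'. border g k b' \<longrightarrow> b' \<le> b)"

section \<open>Borders of a string in terms of their lengths\<close>

lemma is_border_iff:
  "is_border v u \<longleftrightarrow> length v < length u \<and> v = take (length v) u \<and> v = drop (length u - length v) u"
proof
  assume "is_border v u"
  then obtain zs zs' where "u = v @ zs" "v \<noteq> u" and u: "u = zs' @ v"
    unfolding is_border_def strict_prefix_def prefix_def suffix_def by blast
  then have "length v < length u" "v = take (length v) u" by auto
  moreover have "v = drop (length u - length v) u" using u by simp
  ultimately show "length v < length u \<and> v = take (length v) u \<and> v = drop (length u - length v) u"
    by blast
next
  assume *: "length v < length u \<and> v = take (length v) u \<and> v = drop (length u - length v) u"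
  then have "prefix v u" "suffix v u" by (metis take_is_prefix, metis suffix_drop)
  with * show "is_border v u" unfolding is_border_def strict_prefix_def by auto
qed

lemma border_lengths:
  "{length v |v. is_border v (map g [1..<Suc k])} = {b. border g k b}"
proof -
  let ?u = "map g [1..<Suc k]"
  have nth: "?u ! r = g (Suc r)" if "r < k" for r using that by (simp del: upt_Suc)
  have len: "length ?u = k" by simp
  have iff: "take b ?u = drop (k - b) ?u \<longleftrightarrow> border g k b" if b: "b < k" for b
  proof
    assume eq: "take b ?u = drop (k - b) ?u"
    have "g j = g (k - b + j)" if j: "j \<in> {1..b}" for j
    proof -
      have "take b ?u ! (j - 1) = drop (k - b) ?u ! (j - 1)" using eq by simp
      moreover have "take b ?u ! (j - 1) = ?u ! (j - 1)" by (rule nth_take) (use j in auto)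
      moreover have "drop (k - b) ?u ! (j - 1) = ?u ! (k - b + (j - 1))"
        by (rule nth_drop) (use b len in simp)
      moreover have "j - 1 < k" "k - b + (j - 1) < k" "Suc (k - b + (j - 1)) = k - b + j"
        using j b by auto
      ultimately show ?thesis using nth[of "j - 1"] nth[of "k - b + (j - 1)"] j by simp
    qed
    then show "border g k b" unfolding border_def using b by blast
  next
    assume bd: "border g k b"
    show "take b ?u = drop (k - b) ?u"
    proof (rule nth_equalityI)
      fix r assume "r < length (take b ?u)"
      then have r: "r < b" by (simp del: upt_Suc)
      have "g (Suc r) = g (k - b + Suc r)" using bd r unfolding border_def by auto
      moreover have "drop (k - b) ?u ! r = ?u ! (k - b + r)"
        by (rule nth_drop) (use b len in simp)
      ultimately show "take b ?u ! r = drop (k - b) ?u ! r"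
        using nth[of r] nth[of "k - b + r"] r b by (simp del: upt_Suc)
    qed (use b in \<open>simp del: upt_Suc\<close>)
  qed
  have 1: "border g k (length v)" if "is_border v ?u" for v
    using that iff[of "length v"] len unfolding is_border_iff by metis
  have 2: "\<exists>v. b = length v \<and> is_border v ?u" if "border g k b" for b
  proof -
    have b: "b < k" using that unfolding border_def by blast
    have "length (take b ?u) = b" using b len by (simp only: length_take)
    then show ?thesis using iff[OF b] that b len unfolding is_border_iff by metis
  qed
  from 1 2 show ?thesis by blast
qed

lemma longest_border_eq:
  assumes "longest g k b" shows "longest_border (map g [1..<Suc k]) = b"
proof -
  have "finite {b. border g k b}" by (rule finite_subset[of _ "{..<k}"]) (auto simp: border_def)
  then show ?thesis
    using assms unfolding longest_border_def border_lengths longest_def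
    by (intro Max_eqI) auto
qed

lemma border_cong:
  assumes "\<And>i. i \<in> {1..k} \<Longrightarrow> g i = h i" shows "border g k = border h k"
proof
  fix b
  have "g j = h j \<and> g (k - b + j) = h (k - b + j)" if "b < k" "j \<in> {1..b}" for j
  proof -
    have "j \<in> {1..k}" "k - b + j \<in> {1..k}" using that by auto
    then show ?thesis using assms by blast
  qed
  then show "border g k b = border h k b" unfolding border_def by metis
qed

lemma longest_cong:
  assumes "\<And>i. i \<in> {1..k} \<Longrightarrow> g i = h i" shows "longest g k = longest h k"
  using border_cong[OF assms] unfolding longest_def by simp

text \<open>Borders depend only on which letters are equal, so they may be computed on the numeric
  codes in \<open>Txt\<close>.\<close>

lemma longest_inj:
  assumes "inj f" shows "longest (\<lambda>i. f (g i)) = longest g"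
  unfolding longest_def border_def by (simp add: inj_eq[OF assms])

section \<open>Borders of borders\<close>

text \<open>Together with \<open>border_shorter\<close>: the borders of a prefix that are shorter
  than its border \<open>b\<close> are exactly the borders of the prefix of length \<open>b\<close>.
  Following the stored longest borders thus meets every border, in decreasing order.\<close>

lemma border_trans: "border g k b \<Longrightarrow> border g b b' \<Longrightarrow> border g k b'"
proof -
  assume *: "border g k b" "border g b b'"
  have "g j = g (k - b' + j)" if "j \<in> {1..b'}" for j
  proof -
    have "g j = g (b - b' + j)" using * that unfolding border_def by blast
    also have "b - b' + j \<in> {1..b}" using * that unfolding border_def by auto
    then have "g (b - b' + j) = g (k - b + (b - b' + j))" using * unfolding border_def by blast
    also have "k - b + (b - b' + j) = k - b' + j" using * unfolding border_def by auto
    finally show ?thesis .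
  qed
  then show ?thesis using * unfolding border_def by auto
qed

lemma border_shorter: "border g k b \<Longrightarrow> border g k b' \<Longrightarrow> b' < b \<Longrightarrow> border g b b'"
proof -
  assume *: "border g k b" "border g k b'" "b' < b"
  have "g j = g (b - b' + j)" if "j \<in> {1..b'}" for j
  proof -
    have "g j = g (k - b' + j)" using * that unfolding border_def by blast
    also have "k - b' + j = k - b + (b - b' + j)" using * unfolding border_def by auto
    also have "b - b' + j \<in> {1..b}" using * that by auto
    then have "g (k - b + (b - b' + j)) = g (b - b' + j)" using * unfolding border_def by metis
    finally show ?thesis .
  qed
  then show ?thesis using * unfolding border_def by auto
qed

lemma border_Suc:
  assumes "k \<ge> 1"
  shows "border g (Suc k) b \<longleftrightarrow> b = 0 \<or> (\<exists>b0. b = Suc b0 \<and> border g k b0 \<and> g (Suc b0) = g (Suc k))"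
proof (cases b)
  case (Suc b0)
  have "{1..Suc b0} = insert (Suc b0) {1..b0}" by auto
  then show ?thesis using Suc unfolding border_def by auto
qed (simp add: border_def)

text \<open>\<open>b\<close> is where the border loop stops. All longer borders have failed to
  extend; if \<open>b\<close> fails too, then \<open>b = 0\<close> and only the empty border is
  left.\<close>

lemma longest_Suc:
  assumes "k \<ge> 1" and b: "border g k b" "\<And>b'. border g k b' \<Longrightarrow> b < b' \<Longrightarrow> g (Suc b') \<noteq> g (Suc k)"
    and exit: "b = 0 \<or> g (Suc b) = g (Suc k)"
  shows "longest g (Suc k) (if g (Suc b) = g (Suc k) then Suc b else b)"
  using assms(2-) unfolding longest_def border_Suc[OF assms(1)] by (auto simp: not_less[symmetric])

lemma longest_1: "longest g (Suc 0) 0"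
  unfolding longest_def border_def by auto

text \<open>The current border length is the potential, at 20 credits per unit. Every round of the
  loop lowers it by at least one and a new letter raises it by at most one, so the fixed 80
  suffices. At \<open>i = 1\<close> the old potential is set to 0, as \<open>Bord\<close> has no
  meaningful entry yet.\<close>

lemma run_border:
  assumes credits: "K + 20 * (if i = 1 then 0 else arrs s Bord (i - 1)) + 80 \<le> m"
    and st: "vars s vI = i" "1 \<le> i" "\<forall>k\<in>{1..<i}. longest (arrs s Txt) k (arrs s Bord k)"
    and Q: "\<And>m' s'. K + 20 * arrs s' Bord i \<le> m' \<Longrightarrow> vars s' vI = i \<Longrightarrow> vars s' vN = vars s vN \<Longrightarrow>
      (\<And>A. A \<noteq> Bord \<Longrightarrow> arrs s' A = arrs s A) \<Longrightarrow>
      (\<forall>k\<in>{1..i}. longest (arrs s Txt) k (arrs s' Bord k)) \<Longrightarrow> Q m' s'"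
  shows "run border_com m s Q"
proof (cases "i = 1")
  case True
  have "Q m' s'" if "K \<le> m'" "vars s' = vars s" "arrs s' = (arrs s)(Bord := (arrs s Bord)(1 := 0))"
    for m' s'
    by (rule Q) (use that st True longest_1 in auto)
  then show ?thesis
    unfolding border_com_def using True st credits by (simp add: run_simps)
next
  case False
  define g where "g = arrs s Txt"
  define k where "k = i - 1"
  have k: "k \<ge> 1" "i = Suc k" using False st(2) by (auto simp: k_def)
  define I :: "nat \<Rightarrow> state \<Rightarrow> bool" where "I = (\<lambda>m' s'. border g k (vars s' vB) \<and>
      (\<forall>b'. border g k b' \<and> vars s' vB < b' \<longrightarrow> g (Suc b') \<noteq> g i) \<and>
      vars s' vI = i \<and> vars s' vN = vars s vN \<and> arrs s' = arrs s \<and> K + 20 * vars s' vB + 50 \<le> m')"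
  have init: "I m' s'" if "vars s' = (vars s)(vB := arrs s Bord k)" "arrs s' = arrs s"
    "K + 20 * arrs s Bord k + 50 \<le> m'" for m' s'
  proof -
    have "longest g k (arrs s Bord k)" using st(3) k by (simp add: g_def)
    then show ?thesis using that st(1) unfolding I_def longest_def by (auto simp: not_less[symmetric])
  qed
  \<comment> \<open>17 is the exact cost of a round: 14 for the guard and 3 for the
    assignment.\<close>
  have step: "I (m' - 17) s''"
    if I: "I m' s'" and b: "1 \<le> vars s' vB" "g (Suc (vars s' vB)) \<noteq> g i"
      and s'': "vars s'' = (vars s')(vB := arrs s Bord (vars s' vB))" "arrs s'' = arrs s"
    for m' s' s''
  proof -
    define b where "b = vars s' vB"
    have bd: "border g k b" "\<And>b'. border g k b' \<Longrightarrow> b < b' \<Longrightarrow> g (Suc b') \<noteq> g i"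
      using I unfolding I_def b_def by blast+
    have "b \<in> {1..<i}" using b bd(1) k unfolding border_def b_def by auto
    then have L: "longest g b (arrs s Bord b)" using st(3) unfolding g_def by blast
    then have less: "arrs s Bord b < b" "border g k (arrs s Bord b)"
      using border_trans[OF bd(1)] unfolding longest_def border_def by blast+
    \<comment> \<open>The next candidate skips no border: one strictly between it and
      \<open>b\<close> would be a border of the prefix of length \<open>b\<close>, longer than its
      longest.\<close>
    have "g (Suc b') \<noteq> g i" if "border g k b'" "arrs s Bord b < b'" for b'
    proof (cases b' b rule: linorder_cases)
      case less
      then have "border g b b'" using border_shorter[OF bd(1) that(1)] by blast
      then show ?thesis using L that(2) unfolding longest_def by fastforce
    qed (use that bd b b_def in auto)
    moreover have "K + 20 * arrs s Bord b + 50 \<le> m' - 17"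
      using I less(1) unfolding I_def b_def by (elim conjE) linarith
    ultimately show ?thesis using I s'' less unfolding I_def by (simp add: b_def)
  qed
  have exit: "longest g i (if g (Suc (vars s' vB)) = g i then Suc (vars s' vB) else vars s' vB)"
    if "I m' s'" "vars s' vB = 0 \<or> g (Suc (vars s' vB)) = g i" for m' s'
    using longest_Suc[of k g "vars s' vB"] that k unfolding I_def by auto
  have final: "Q m' s''"
    if I: "I m0 s'" and "vars s'' vI = i" "vars s'' vN = vars s vN" "longest g i b" "K + 20 * b \<le> m'"
      and arrs: "arrs s'' = (arrs s)(Bord := (arrs s Bord)(i := b))" for m0 m' s' s'' b
  proof (rule Q)
    show "\<forall>k\<in>{1..i}. longest (arrs s Txt) k (arrs s'' Bord k)"
      using that st(3) by (auto simp: g_def)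
  qed (use that in auto)
  let ?guard = "N 1 \<preceq> V vB \<sqinter> Txt\<langle>V vB \<oplus> N 1\<rangle> \<noteq>\<^sub>e Txt\<langle>V vI\<rangle>"
  have I_D: "arrs s' = arrs s" "vars s' vI = i" "vars s' vN = vars s vN" "K + 20 * vars s' vB + 50 \<le> m'"
    if "I m' s'" for m' s'
    using that unfolding I_def by blast+
  have body: "run (vB ::= Bord\<langle>V vB\<rangle>) (m' - (1 + bcost ?guard)) s' I"
    if I: "I m' s'" and b: "bval ?guard s'" for m' s'
  proof -
    have "I (m' - 17) (set_var vB (arrs s' Bord (vars s' vB)) s')"
      by (rule step[OF I]) (use b I_D[OF I] in \<open>auto simp: set_var_def g_def\<close>)
    then show ?thesis using I_D[OF I] by (simp add: run_Assign del: One_nat_def)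
  qed
  have tail: "run (IF Txt\<langle>V vB \<oplus> N 1\<rangle> \<doteq> Txt\<langle>V vI\<rangle> THEN vB ::= V vB \<oplus> N 1 ELSE Skip)
      (m' - (1 + bcost ?guard)) s' (\<lambda>m' s'. run (Bord\<langle>V vI\<rangle> ::= V vB) m' s' Q)"
    if I: "I m' s'" and b: "\<not> bval ?guard s'" for m' s'
  proof -
    have L: "longest g i (if g (Suc (vars s' vB)) = g i then Suc (vars s' vB) else vars s' vB)"
      by (rule exit[OF I]) (use b I_D[OF I] in \<open>auto simp: g_def\<close>)
    show ?thesis
    proof (cases "g (Suc (vars s' vB)) = g i")
      case True
      show ?thesis
        apply (simp add: run_simps I_D[OF I] True[unfolded g_def])
        apply (intro conjI)
        subgoal using I_D(4)[OF I] by linarith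
        subgoal using I_D(4)[OF I] by linarith
        subgoal using I_D(4)[OF I] by linarith
        subgoal
          by (rule final[OF I, where b = "Suc (vars s' vB)"])
            (use L True I_D[OF I] in \<open>simp_all\<close>)
        done
    next
      case False
      show ?thesis
        apply (simp add: run_simps I_D[OF I] False[unfolded g_def])
        apply (intro conjI)
        subgoal using I_D(4)[OF I] by linarith
        subgoal using I_D(4)[OF I] by linarith
        subgoal using I_D(4)[OF I] by linarith
        subgoal
          by (rule final[OF I, where b = "vars s' vB"])
            (use L False I_D[OF I] in \<open>simp_all\<close>)
        done
    qed
  qed
  show ?thesis
    unfolding border_com_def using False st(1)
    apply (simp add: run_If run_Seq del: One_nat_def)
    apply (simp add: run_Assign set_var_def del: One_nat_def)
    apply (intro conjI)
    subgoal using credits by simp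
    subgoal using credits by simp
    subgoal
      apply (rule run_While[where I = I])
      subgoal
        apply (rule init)
        subgoal by (simp add: k_def)
        subgoal by simp
        subgoal using credits False by (simp add: k_def)
        done
      subgoal by (auto simp: I_def)
      subgoal by (rule body)
      subgoal by (rule tail)
      done
    done
qed

section \<open>Inference\<close>

definition decode :: "letter option \<Rightarrow> nat" where
  "decode z = (case z of None \<Rightarrow> 0 | Some l \<Rightarrow> code l)"

lemma decode_simps [simp]: "decode None = 0" "decode (Some l) = code l"
  by (simp_all add: decode_def)

lemma code_pos [simp]: "0 < code l"
  by (cases l) simp_all

lemma inj_code: "inj code"
proof (rule injI)
  show "code a = code b \<Longrightarrow> a = b" for a b by (cases a; cases b) simp_all
qed

lemma decode_eq_0_iff [simp]: "decode z = 0 \<longleftrightarrow> z = None"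
  by (cases z) simp_all

lemma decode_eq_code_iff [simp]: "decode z = code l \<longleftrightarrow> z = Some l"
  by (cases z) (simp_all add: inj_eq[OF inj_code])

text \<open>The empty stack says that no search is running. Positions from \<open>i\<close> on may
  have letters too, from components found earlier; only those before \<open>i\<close> are guaranteed
  one.\<close>

definition loop_state ::
  "nat \<Rightarrow> nat \<Rightarrow> (nat \<times> nat) set \<Rightarrow> nat \<Rightarrow> (nat \<Rightarrow> letter option) \<Rightarrow> (nat \<Rightarrow> nat list) \<Rightarrow> state \<Rightarrow> bool"
  where
  "loop_state n E R i x p s \<longleftrightarrow> vars s vI = i \<and> vars s vN = n \<and> search_state n E R {} p s \<and>
    (\<forall>q\<in>{1..n}. arrs s Txt q = decode (x q)) \<and> (\<forall>q\<in>{1..<i}. x q \<noteq> None) \<and>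
    (\<forall>k\<in>{1..<i}. longest (arrs s Txt) k (arrs s Bord k))"

text \<open>Connects the stored border with the specification, which sees letters instead of codes.
  The strict bound places the compared position, one past the border, inside the known
  prefix.\<close>

lemma longest_border_prefix:
  assumes "loop_state n E R (Suc k) x p s" "1 \<le> k" "k \<le> n"
  shows "longest_border (map (\<lambda>q. the (x q)) [1..<Suc k]) = arrs s Bord k"
    and "arrs s Bord k < k"
proof -
  have L: "longest (arrs s Txt) k (arrs s Bord k)" using assms unfolding loop_state_def by auto
  then show "arrs s Bord k < k" unfolding longest_def border_def by blast
  have "arrs s Txt q = code (the (x q))" if "q \<in> {1..k}" for q
  proof -
    have "q \<in> {1..n}" "q \<in> {1..<Suc k}" using that assms by auto
    then have "arrs s Txt q = decode (x q)" "x q \<noteq> None"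
      using assms unfolding loop_state_def by blast+
    then show ?thesis by auto
  qed
  then have "longest (\<lambda>q. code (the (x q))) k (arrs s Bord k)"
    using L longest_cong[of k "arrs s Txt" "\<lambda>q. code (the (x q))"] by simp
  then have "longest (\<lambda>q. the (x q)) k (arrs s Bord k)"
    using longest_inj[OF inj_code, of "\<lambda>q. the (x q)"] by simp
  then show "longest_border (map (\<lambda>q. the (x q)) [1..<Suc k]) = arrs s Bord k"
    by (rule longest_border_eq)
qed

lemma run_choose_letter:
  assumes credits: "K + 20 \<le> m" and st: "loop_state n E R i x p s" "1 \<le> i" "i \<le> n"
    and Q: "\<And>m' s'. K \<le> m' \<Longrightarrow> vars s' = (vars s)(vC := code (choose_letter x i)) \<Longrightarrow>
      arrs s' = arrs s \<Longrightarrow> Q m' s'"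
  shows "run choose_letter_com m s Q"
proof -
  have vI: "vars s vI = i" using st(1) unfolding loop_state_def by blast
  show ?thesis
  proof (cases "i = 1")
    case True
    show ?thesis
      unfolding choose_letter_com_def
      apply (simp add: run_simps vI True)
      apply (intro conjI)
      subgoal using credits by linarith
      subgoal using credits by linarith
      subgoal by (rule Q) (use credits True in \<open>simp_all add: choose_letter_def\<close>)
      done
  next
    case False
    then obtain k where k: "i = Suc k" "1 \<le> k" "k \<le> n" using st by (cases i) auto
    note B = longest_border_prefix[OF st(1)[unfolded k(1)] k(2,3)]
    have "arrs s Txt (Suc (arrs s Bord k)) = decode (x (Suc (arrs s Bord k)))"
      using st(1) B(2) k unfolding loop_state_def by auto
    then have *: "arrs s Txt (Suc (arrs s Bord k)) = Suc 0 \<longleftrightarrow> x (Suc (arrs s Bord k)) = Some La"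
      using decode_eq_code_iff[of "x (Suc (arrs s Bord k))" La] by simp
    have c: "choose_letter x i = (if x (Suc (arrs s Bord k)) = Some La then Lb else La)"
      using False B(1) unfolding choose_letter_def k(1) Let_def by simp
    have "k \<noteq> 0" using k(2) by simp
    show ?thesis
    proof (cases "x (Suc (arrs s Bord k)) = Some La")
      case True
      show ?thesis
        unfolding choose_letter_com_def
        apply (simp add: run_simps vI k(1) * True \<open>k \<noteq> 0\<close>)
        apply (intro conjI)
        subgoal using credits by linarith
        subgoal using credits by linarith
        subgoal using credits by linarith
        subgoal by (rule Q) (use credits c True in simp_all)
        done
    next
      case False
      show ?thesis
        unfolding choose_letter_com_def
        apply (simp add: run_simps vI k(1) * False \<open>k \<noteq> 0\<close>)
        apply (intro conjI)
        subgoal using credits by linarith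
        subgoal using credits by linarith
        subgoal using credits by linarith
        subgoal by (rule Q) (use credits c False in simp_all)
        done
    qed
  qed
qed

section \<open>The inference loop with its shared budget\<close>

text \<open>Three kinds of credit meet here: 40 per unit of workload for all searches, 20 per unit
  of the current border, and 130 per position for the rest.\<close>

lemma run_infer_loop:
  assumes credits: "K + 40 * workload n p s + 130 * n + 10 \<le> m"
    and C: "\<And>i. i \<in> {1..n} \<Longrightarrow> C i < i"
    and st: "loop_state n E (edge_rel n C) 1 (\<lambda>_. None) p s"
    and Q: "\<And>m' s'. K \<le> m' \<Longrightarrow> holds_output (infer n C) s' \<Longrightarrow> Q m' s'"
  shows "run (WHILE V vI \<preceq> V vN DO (
      IF Txt\<langle>V vI\<rangle> \<doteq> N 0 THEN (choose_letter_com;; dfs_com) ELSE Skip;;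
      border_com;;
      vI ::= V vI \<oplus> N 1)) m s Q"
proof -
  define R where "R = edge_rel n C"
  have R: "R \<subseteq> {1..n} \<times> {1..n}" "sym R"
    unfolding R_def using edge_rel_subset[OF C] edge_rel_sym by blast+
  define x where "x = (\<lambda>i. fold (infer_step n C) [1..<i] (\<lambda>_. None))"
  have x_Suc: "x (Suc i) = infer_step n C i (x i)" if "1 \<le> i" for i
    using that unfolding x_def by simp
  define bord :: "state \<Rightarrow> nat \<Rightarrow> nat" where "bord = (\<lambda>s i. if i = 1 then 0 else arrs s Bord (i - 1))"
  define I :: "nat \<Rightarrow> state \<Rightarrow> bool" where "I = (\<lambda>m' s'. \<exists>i p'. 1 \<le> i \<and> i \<le> n + 1 \<and>
      loop_state n E R i (x i) p' s' \<and>
      K + 40 * workload n p' s' + 20 * bord s' i + 130 * (n + 1 - i) + 6 \<le> m')"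
  \<comment> \<open>Both branches end here. \<open>x'\<close> is already \<open>x (Suc i)\<close>
    while the counter is still \<open>i\<close>, since a search writes its letters before the
    counter moves.\<close>
  have finish: "run (border_com;; vI ::= V vI \<oplus> N 1) m1 s1 I"
    if st: "loop_state n E R i x' p' s1" and i: "1 \<le> i" "i \<le> n" and x': "x' i \<noteq> None" "x' = x (Suc i)"
      and m1: "K + 40 * workload n p' s1 + 20 * bord s1 i + 130 * (n - i) + 100 \<le> m1"
    for m1 s1 i p' x'
    apply (simp only: run_Seq)
    apply (rule run_border[where i = i and K = "K + 40 * workload n p' s1 + 130 * (n - i) + 10"])
    subgoal using m1 unfolding bord_def by auto
    subgoal using st unfolding loop_state_def by blast
    subgoal by (rule i)
    subgoal using st unfolding loop_state_def by blast
    subgoal premises prems for m2 s2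
    proof -
      let ?s = "set_var vI (Suc i) s2"
      have eq: "arrs ?s A = arrs s1 A" if "A \<noteq> Bord" for A
        using prems(4)[OF that] by (simp add: set_var_def)
      have "x' q \<noteq> None" if "q \<in> {1..<Suc i}" for q
        using st x' that unfolding loop_state_def by (cases "q = i") auto
      moreover have "search_state n E R {} p' ?s"
        by (rule search_state_cong[of _ _ _ _ _ s1]) (use st eq in \<open>auto simp: loop_state_def\<close>)
      moreover have "{1..<Suc i} = {1..i}" by auto
      ultimately have "loop_state n E R (Suc i) x' p' ?s"
        using st prems(2,3,5) eq[of Txt] unfolding loop_state_def by (simp add: set_var_def)
      moreover have "workload n p' ?s = workload n p' s1" using eq by (intro workload_cong) simp
      moreover have "bord ?s (Suc i) = arrs s2 Bord i" using i by (simp add: bord_def set_var_def)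
      ultimately have "I k ?s" if "m2 \<le> k + 4" for k
        unfolding I_def using that i x' prems(1)
        by (intro exI[of _ "Suc i"] exI[of _ p']) simp
      then have "I (m2 - 4) ?s" by simp
      then show ?thesis
        using prems(1,2) by (simp add: run_Assign del: One_nat_def) (simp add: set_var_def)
    qed
    done
  have step: "run (
      IF Txt\<langle>V vI\<rangle> \<doteq> N 0 THEN (choose_letter_com;; dfs_com) ELSE Skip;;
      border_com;;
      vI ::= V vI \<oplus> N 1) (m' - 5) s' I"
    if I: "I m' s'" and le: "vars s' vI \<le> vars s' vN" for m' s'
  proof -
    obtain i p' where i: "1 \<le> i" "i \<le> n + 1" and ls: "loop_state n E R i (x i) p' s'"
      and m': "K + 40 * workload n p' s' + 20 * bord s' i + 130 * (n + 1 - i) + 6 \<le> m'"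
      using I unfolding I_def by blast
    have vI: "vars s' vI = i" and vN: "vars s' vN = n" and ss: "search_state n E R {} p' s'"
      and letters: "\<And>q. q \<in> {1..n} \<Longrightarrow> arrs s' Txt q = decode (x i q)"
      and lng: "\<And>k. k \<in> {1..<i} \<Longrightarrow> longest (arrs s' Txt) k (arrs s' Bord k)"
      and old: "\<And>q. q \<in> {1..<i} \<Longrightarrow> x i q \<noteq> None"
      using ls unfolding loop_state_def by blast+
    have i': "i \<le> n" "i \<in> {1..n}" using le vI vN i by auto
    have bound: "K + 40 * workload n p' s' + 20 * bord s' i + 130 * (n - i) + 136 \<le> m'"
      using m' i' by linarith
    show ?thesis
    proof (cases "x i i")
      case (Some l)
      have "run (border_com;; vI ::= V vI \<oplus> N 1) (m' - 11) s' I"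
      proof (rule finish[OF ls i(1) i'(1)])
        show "x i i \<noteq> None" "x i = x (Suc i)"
          using Some x_Suc[OF i(1)] by (simp_all add: infer_step_def)
        show "K + 40 * workload n p' s' + 20 * bord s' i + 130 * (n - i) + 100 \<le> m' - 11"
          using bound by linarith
      qed
      moreover have "5 \<le> m' - 5" "1 \<le> m' - 10" using bound by linarith+
      moreover have "arrs s' Txt (vars s' vI) \<noteq> 0" using letters[OF i'(2)] Some vI by simp
      ultimately show ?thesis by (simp add: run_Seq run_If run_Skip del: One_nat_def)
    next
      case None
      define c where "c = choose_letter (x i) i"
      have comp: "component n C i = {q \<in> {1..n}. (i, q) \<in> R\<^sup>*}"
        unfolding component_def R_def ..
      have xS: "x (Suc i) q = (if (i, q) \<in> R\<^sup>* then Some c else x i q)" if "q \<in> {1..n}" for q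
        using x_Suc[OF i(1)] None that by (simp add: infer_step_def comp c_def)
      \<comment> \<open>\<open>i\<close> is the least element of its component: the search leaves
        the earlier letters alone, so the borders stored for them stay correct.\<close>
      have unreached: "(i, q) \<notin> R\<^sup>*" if "q \<in> {1..<i}" for q
      proof
        assume "(i, q) \<in> R\<^sup>*"
        then have "(q, i) \<in> R\<^sup>*" using R(2) by (meson symD sym_rtrancl)
        moreover have "arrs s' Txt q \<noteq> 0" using letters[of q] old[OF that] that i' by simp
        ultimately have "arrs s' Txt i \<noteq> 0" using search_state_closed[OF ss _ R(1)] by blast
        then show False using letters[OF i'(2)] None by simp
      qed
      let ?K = "K + 20 * bord s' i + 130 * (n - i) + 100"
      have "run choose_letter_com (m' - 10) s' (\<lambda>m1 s1. run dfs_com m1 s1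
          (\<lambda>m2 s2. run (border_com;; vI ::= V vI \<oplus> N 1) m2 s2 I))"
      proof (rule run_choose_letter[OF _ ls i(1) i'(1), where K = "?K + 40 * workload n p' s'"])
        show "?K + 40 * workload n p' s' + 20 \<le> m' - 10" using bound by linarith
        fix m1 and s1 :: state
        assume m1: "?K + 40 * workload n p' s' \<le> m1"
          and s1: "vars s1 = (vars s')(vC := code (choose_letter (x i) i))" "arrs s1 = arrs s'"
        have v1: "vars s1 vI = i" "vars s1 vC = code c" "vars s1 vN = n"
          using s1 vI ls by (simp_all add: c_def loop_state_def)
        show "run dfs_com m1 s1 (\<lambda>m2 s2. run (border_com;; vI ::= V vI \<oplus> N 1) m2 s2 I)"
        proof (rule run_dfs[OF _ R, where K = ?K and E = E and p = p'])
          show "?K + 40 * workload n p' s1 \<le> m1" using m1 workload_cong[of s1 s'] s1 by simp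
          show "search_state n E R {} p' s1"
            by (rule search_state_cong[OF ss]) (use s1 in simp)
          show "arrs s1 Txt (vars s1 vI) = 0" using v1 s1 letters[OF i'(2)] None by simp
          show "vars s1 vI \<in> {1..n}" "vars s1 vC \<noteq> 0" using v1 i' by simp_all
          fix m2 p2 and s2 :: state
          assume m2: "?K + 40 * workload n p2 s2 \<le> m2" and ss2: "search_state n E R {} p2 s2"
            and v2: "vars s2 vI = vars s1 vI" "vars s2 vN = vars s1 vN" "arrs s2 Bord = arrs s1 Bord"
            and t2: "\<forall>q\<in>{1..n}. arrs s2 Txt q =
              (if (vars s1 vI, q) \<in> R\<^sup>* then vars s1 vC else arrs s1 Txt q)"
          have "arrs s2 Txt q = decode (x (Suc i) q)" if "q \<in> {1..n}" for q
            using t2 that v1 s1 letters xS by simp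
          moreover have "x (Suc i) q \<noteq> None" if "q \<in> {1..<i}" for q
            using xS[of q] old[OF that] that i' by simp
          moreover have "longest (arrs s2 Txt) k (arrs s2 Bord k)" if "k \<in> {1..<i}" for k
          proof -
            have "arrs s2 Txt q = arrs s' Txt q" if "q \<in> {1..k}" for q
              using t2 unreached[of q] that \<open>k \<in> {1..<i}\<close> i' v1 s1 by simp
            then show ?thesis using longest_cong[of k "arrs s2 Txt" "arrs s' Txt"] lng[OF that] v2 s1 by simp
          qed
          ultimately have "loop_state n E R i (x (Suc i)) p2 s2"
            using ss2 v1 v2 unfolding loop_state_def by simp
          moreover have "bord s2 i = bord s' i" using v2 s1 by (simp add: bord_def)
          moreover have "x (Suc i) i \<noteq> None" using xS[OF i'(2)] by simp
          ultimately show "run (border_com;; vI ::= V vI \<oplus> N 1) m2 s2 I"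
            using m2 by (intro finish[of i "x (Suc i)" p2]) (use i i' in simp_all)
        qed
      qed
      note this[unfolded run_Seq]
      moreover have "5 \<le> m' - 5" using bound by linarith
      moreover have "arrs s' Txt (vars s' vI) = 0" using letters[OF i'(2)] None vI by simp
      ultimately show ?thesis by (simp add: run_Seq run_If del: One_nat_def)
    qed
  qed
  show ?thesis
    apply (rule run_While[where I = I])
    subgoal using credits st unfolding I_def
      by (intro exI[of _ 1] exI[of _ p]) (simp add: R_def x_def bord_def)
    subgoal by (auto simp: I_def)
    subgoal for m' s'
      using step[of m' s'] by (simp del: One_nat_def)
    subgoal premises prems for m' s'
    proof -
      obtain i p' where i: "i \<le> n + 1" and ls: "loop_state n E R i (x i) p' s'" and m': "K + 6 \<le> m'"
        using prems(1) unfolding I_def by fastforce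
      have "i = n + 1" using prems(2) i ls by (simp add: loop_state_def)
      then have "arrs s' Txt q = code (the (x (n + 1) q))" if "q \<in> {1..n}" for q
        using ls that unfolding loop_state_def by force
      then have "holds_output (infer n C) s'"
        unfolding holds_output_def infer_def x_def[symmetric] by (simp add: x_def del: upt_Suc)
      then show ?thesis using m' by (intro Q) auto
    qed
    done
qed

text \<open>Of the 150 credits per edge, 60 build its two arcs and 80 let the searches scan the two
  cells at 40 each; the rest is slack.\<close>

lemma run_infer:
  assumes credits: "K + 150 * (\<Sum>i\<in>{1..n}. C i) + 300 * n + 50 \<le> m"
    and st: "vars s vN = n" "arrs s Cov = C" and C: "\<And>i. i \<in> {1..n} \<Longrightarrow> C i < i"
    and Q: "\<And>m' s'. K \<le> m' \<Longrightarrow> holds_output (infer n C) s' \<Longrightarrow> Q m' s'"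
  shows "run infer_com m s Q"
  unfolding infer_com_def run_Seq
proof (rule run_init[where n = n and K = "K + 150 * (\<Sum>i\<in>{1..n}. C i) + 270 * n + 40"])
  show "K + 150 * (\<Sum>i\<in>{1..n}. C i) + 270 * n + 40 + 30 * n + 10 \<le> m" using credits by linarith
  show "vars s vN = n" by (rule st)
  fix m1 and s1 :: state
  assume m1: "K + 150 * (\<Sum>i\<in>{1..n}. C i) + 270 * n + 40 \<le> m1" and s1: "vars s1 vN = n"
    "arrs s1 Cov = arrs s Cov" "\<forall>v\<in>{1..n}. arrs s1 Head v = 0 \<and> arrs s1 Txt v = 0"
  show "run build_graph_com m1 s1 (\<lambda>m' s'. run (vI ::= N 1) m' s' (\<lambda>m' s'.
      run (WHILE V vI \<preceq> V vN DO (
        IF Txt\<langle>V vI\<rangle> \<doteq> N 0 THEN choose_letter_com;; dfs_com ELSE Skip;;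
        border_com;;
        vI ::= V vI \<oplus> N 1)) m' s' Q))"
  proof (rule run_build_graph[where n = n and C = C and K = "K + 90 * (\<Sum>i\<in>{1..n}. C i) + 240 * n + 30"])
    show "K + 90 * (\<Sum>i\<in>{1..n}. C i) + 240 * n + 30 + 60 * (\<Sum>i\<in>{1..n}. C i) + 30 * n + 10 \<le> m1"
      using m1 by linarith
    fix m2 and s2 :: state
    assume m2: "K + 90 * (\<Sum>i\<in>{1..n}. C i) + 240 * n + 30 \<le> m2" and s2: "vars s2 vN = n"
      "arrs s2 Txt = arrs s1 Txt" "stores_graph n s2 (2 * (\<Sum>i\<in>{1..n}. C i)) (edge_rel n C)"
    let ?E = "2 * (\<Sum>i\<in>{1..n}. C i)" and ?s = "set_var vI 1 s2"
    obtain p where p: "adjacency n s2 ?E p" "\<forall>v\<in>{1..n}. set (p v) = edge_rel n C `` {v}"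
      "(\<Sum>v\<in>{1..n}. length (p v)) = ?E"
      using s2(3) unfolding stores_graph_def by blast
    have "search_state n ?E (edge_rel n C) {} p ?s"
      using p s1(3) s2(2) unfolding search_state_def adjacency_def by (simp add: set_var_def)
    then have ls: "loop_state n ?E (edge_rel n C) 1 (\<lambda>_. None) p ?s"
      using s1(3) s2 unfolding loop_state_def by (simp add: set_var_def)
    have "card {v \<in> {1..n}. arrs ?s Txt v = 0} \<le> card {1..n}" by (rule card_mono) auto
    \<comment> \<open>One bound for all searches together: a cell is scanned at most once and a
      vertex is assigned at most once.\<close>
    then have "workload n p ?s \<le> ?E + 2 * n" unfolding workload_def p(3) by simp
    then have load: "K + 40 * workload n p ?s + 130 * n + 10 \<le> m2 - 2" "2 \<le> m2"
      using m2 by linarith+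
    show "run (vI ::= N 1) m2 s2 (\<lambda>m' s'. run (WHILE V vI \<preceq> V vN DO (
        IF Txt\<langle>V vI\<rangle> \<doteq> N 0 THEN choose_letter_com;; dfs_com ELSE Skip;;
        border_com;;
        vI ::= V vI \<oplus> N 1)) m' s' Q)"
      using run_infer_loop[OF load(1) C ls Q] load(2) by (simp add: run_Assign del: One_nat_def)
  qed (use s1 st C in auto)
qed

section \<open>Independence of values outside the index range\<close>

lemma edge_rel_cong:
  assumes "\<And>i. i \<in> {1..n} \<Longrightarrow> C i = D i" shows "edge_rel n C = edge_rel n D"
  unfolding edge_rel_def using assms by auto

lemma infer_cong:
  assumes "\<And>i. i \<in> {1..n} \<Longrightarrow> C i = D i" shows "infer n C = infer n D"
proof -
  have "edge_rel n C = edge_rel n D" using assms by (rule edge_rel_cong)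
  then have "component n C = component n D" unfolding component_def by simp
  then have "infer_step n C = infer_step n D" unfolding infer_step_def by presburger
  then show ?thesis unfolding infer_def by presburger
qed

theorem theorem3:
  shows "\<exists>k :: nat. \<forall>n \<ge> 1. \<forall>C. valid_cover_array n C \<longrightarrow>
    (\<forall>s. holds_input n C s \<longrightarrow>
      (\<exists>t s'. exec sima_com s t s' \<and> holds_output (sima n C) s' \<and> t \<le> k * n))"
\<comment> \<open>With the sum bounded by \<open>2 * n\<close>, inference needs 600 credits per
  position; pruning adds 40 and the first step 30. The additive constants are absorbed because
  \<open>1 \<le> n\<close>.\<close>
proof (rule exI[of _ 800], intro allI impI)
  fix n :: nat and C :: "nat \<Rightarrow> nat" and s :: state
  assume n: "1 \<le> n" and "valid_cover_array n C" and input: "holds_input n C s"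
  then obtain y :: "nat list" where y: "length y = n"
    and C: "(\<forall>i\<in>{1..n}. C i = min_cover_array y i) \<or> (\<forall>i\<in>{1..n}. C i = max_cover_array y i)"
    unfolding valid_cover_array_def by blast
  have vN: "vars s vN = n" and Cov: "\<And>i. i \<in> {1..n} \<Longrightarrow> arrs s Cov i = C i"
    using input unfolding holds_input_def by auto
  \<comment> \<open>The program starts from the contents of memory, which match \<open>C\<close>
    only on \<open>{1..n}\<close>; there, Step 1 yields the minimal-cover array from either.\<close>
  define D where "D = max_to_min n (arrs s Cov)"
  have D: "D i = min_cover_array y i" if "i \<in> {1..n}" for i
    using max_to_min_valid[of y "arrs s Cov" i] that C Cov unfolding D_def y by auto
  have CD: "max_to_min n C i = D i" if "i \<in> {1..n}" for i
    using max_to_min_valid[of y C i] that C D unfolding y by auto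
  have D_less: "D i < i" if "i \<in> {1..n}" for i
    using D[OF that] min_cover_array_less[of i y] that y by simp
  have overlap: "2 * (i - (j - D j)) \<le> D i" if "1 \<le> i" "i < j" "j \<le> n" "D i \<noteq> 0" "D j \<noteq> 0"
    "i - D i < j - D j" "j - D j < i" for i j
    using min_cover_overlap[of i j y] that D[of i] D[of j] y by simp
  note prune = prune_bounds[of n D, OF D_less overlap]
  have out: "infer n (prune n D) = sima n C"
    unfolding sima_def using CD by (intro infer_cong prune_cong) simp_all
  have "run sima_com (800 * n) s (\<lambda>_. holds_output (sima n C))"
    unfolding sima_com_def run_Seq
  proof (rule run_max_to_min[where n = n and K = "700 * n"])
    fix m1 and s1 :: state
    assume m1: "700 * n \<le> m1" and s1: "vars s1 vN = n" "arrs s1 Cov = max_to_min n (arrs s Cov)"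
    show "run prune_com m1 s1 (\<lambda>m' s'. run infer_com m' s' (\<lambda>_. holds_output (sima n C)))"
    proof (rule run_prune[where n = n and K = "650 * n"])
      fix m2 and s2 :: state
      assume m2: "650 * n \<le> m2" and s2: "vars s2 vN = n" "arrs s2 Cov = prune n (arrs s1 Cov)"
      show "run infer_com m2 s2 (\<lambda>_. holds_output (sima n C))"
      proof (rule run_infer[where n = n and C = "prune n D" and K = 0])
        show "0 + 150 * (\<Sum>i\<in>{1..n}. prune n D i) + 300 * n + 50 \<le> m2"
          using m2 prune(2) n by linarith
      qed (use s1 s2 prune(1) out in \<open>simp_all add: D_def\<close>)
    qed (use m1 s1 n in auto)
  qed (use vN n in auto)
  then show "\<exists>t s'. exec sima_com s t s' \<and> holds_output (sima n C) s' \<and> t \<le> 800 * n"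
    unfolding run_def by blast
qed

end
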